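(* Let $\Pi'$ be a polar space of rank $l\ge 3$ and $\Pi$ a polar space of rank $n$, and let $k\le n-2$. If $f$ is a $3$-embedding of the dual polar graph $\Gamma_{l-1}(\Pi')$ in the polar Grassmann graph $\Gamma_k(\Pi)$, then $k\le n-4$ and there is a singular subspace $U$ of $\Pi$ such that the image of $f$ is contained in $\langle U]_k$.
   Context: Polar space: a partial linear space (points and lines, each line with at least two points, two distinct points on at most one line; collinear points written $p\perp q$) in which every line has at least three points, no point is collinear with all points, every point is collinear with one or all points of any line, and chains of distinct incident singular subspaces (subspaces in which any two points are collinear; a subspace contains the line through any two of its collinear points) are finite. Singular subspaces are projective spaces; dimension is projective dimension (empty set: $-1$); rank $n$ means maximal singular subspaces have dimension $n-1$. $\mathcal G_k(\Pi)$ is the set of $k$-dimensional singular subspaces. For $k\le n-2$, $\Gamma_k(\Pi)$ is the graph on $\mathcal G_k(\Pi)$ in which distinct vertices are adjacent iff some $(k+1)$-dimensional singular subspace contains both. The dual polar graph $\Gamma_{l-1}(\Pi')$ has as vertices the maximal singular subspaces of $\Pi'$, two being adjacent iff their intersection is $(l-2)$-dimensional. $\langle U]_k$ denotes the set of elements of $\mathcal G_k(\Pi)$ contained in $U$. An embedding of a graph in another is an injection of vertex sets preserving adjacency and non-adjacency; it is a $3$-embedding if it preserves every graph distance not greater than $3$. *)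

theory Defs
  imports Main "HOL-Library.Extended_Nat"
begin

record 'p geometry =
  points :: "'p set"
  lines :: "'p set set"

definition partial_linear_space :: "'p geometry \<Rightarrow> bool" where
  "partial_linear_space \<Pi> \<longleftrightarrow>
     (\<forall>L\<in>lines \<Pi>. L \<subseteq> points \<Pi> \<and> (\<exists>p\<in>L. \<exists>q\<in>L. p \<noteq> q)) \<and>
     (\<forall>L\<in>lines \<Pi>. \<forall>M\<in>lines \<Pi>. \<forall>p q. p \<noteq> q \<longrightarrow> {p, q} \<subseteq> L \<inter> M \<longrightarrow> L = M)"

text \<open>Every point counts as collinear with itself.  Otherwise the last two axioms of a polar space,
  quoted literally, would respectively be trivial and fail for a point lying on the given line.\<close>

definition collinear :: "'p geometry \<Rightarrow> 'p \<Rightarrow> 'p \<Rightarrow> bool" where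
  "collinear \<Pi> p q \<longleftrightarrow> p \<in> points \<Pi> \<and> q \<in> points \<Pi> \<and> (p = q \<or> (\<exists>L\<in>lines \<Pi>. p \<in> L \<and> q \<in> L))"

definition subspace :: "'p geometry \<Rightarrow> 'p set \<Rightarrow> bool" where
  "subspace \<Pi> S \<longleftrightarrow> S \<subseteq> points \<Pi> \<and>
     (\<forall>p\<in>S. \<forall>q\<in>S. \<forall>L\<in>lines \<Pi>. p \<noteq> q \<longrightarrow> p \<in> L \<longrightarrow> q \<in> L \<longrightarrow> L \<subseteq> S)"

definition singular_subspace :: "'p geometry \<Rightarrow> 'p set \<Rightarrow> bool" where
  "singular_subspace \<Pi> S \<longleftrightarrow> subspace \<Pi> S \<and> (\<forall>p\<in>S. \<forall>q\<in>S. collinear \<Pi> p q)"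

definition maximal_singular :: "'p geometry \<Rightarrow> 'p set \<Rightarrow> bool" where
  "maximal_singular \<Pi> M \<longleftrightarrow> singular_subspace \<Pi> M \<and>
     (\<forall>S. singular_subspace \<Pi> S \<longrightarrow> M \<subseteq> S \<longrightarrow> S = M)"

definition polar_space :: "'p geometry \<Rightarrow> bool" where
  "polar_space \<Pi> \<longleftrightarrow> partial_linear_space \<Pi> \<and>
     (\<forall>L\<in>lines \<Pi>. \<exists>p\<in>L. \<exists>q\<in>L. \<exists>r\<in>L. p \<noteq> q \<and> p \<noteq> r \<and> q \<noteq> r) \<and>
     (\<forall>C. (\<forall>S\<in>C. singular_subspace \<Pi> S) \<longrightarrow> (\<forall>S\<in>C. \<forall>T\<in>C. S \<subseteq> T \<or> T \<subseteq> S) \<longrightarrow> finite C) \<and>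
     (\<forall>p\<in>points \<Pi>. \<not> (\<forall>q\<in>points \<Pi>. collinear \<Pi> p q)) \<and>
     (\<forall>p\<in>points \<Pi>. \<forall>L\<in>lines \<Pi>. (\<exists>!q. q \<in> L \<and> collinear \<Pi> p q) \<or> (\<forall>q\<in>L. collinear \<Pi> p q))"

text \<open>Projective dimension: one less than the number of elements of a base, a base being an
  independent generating set.  The span may be taken in the ambient geometry, since the subspaces
  of a singular subspace \<open>S\<close> are the subspaces of the geometry contained in \<open>S\<close>.\<close>

definition span :: "'p geometry \<Rightarrow> 'p set \<Rightarrow> 'p set" where
  "span \<Pi> X = \<Inter>{S. subspace \<Pi> S \<and> X \<subseteq> S}"

definition independent :: "'p geometry \<Rightarrow> 'p set \<Rightarrow> bool" where
  "independent \<Pi> X \<longleftrightarrow> (\<forall>Y. Y \<subset> X \<longrightarrow> span \<Pi> Y \<noteq> span \<Pi> X)"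

definition has_dim :: "'p geometry \<Rightarrow> 'p set \<Rightarrow> int \<Rightarrow> bool" where
  "has_dim \<Pi> S d \<longleftrightarrow>
     (\<exists>B\<subseteq>points \<Pi>. finite B \<and> independent \<Pi> B \<and> span \<Pi> B = S \<and> d = int (card B) - 1)"

definition has_rank :: "'p geometry \<Rightarrow> nat \<Rightarrow> bool" where
  "has_rank \<Pi> n \<longleftrightarrow> (\<forall>M. maximal_singular \<Pi> M \<longrightarrow> has_dim \<Pi> M (int n - 1))"

definition grassmannian :: "'p geometry \<Rightarrow> int \<Rightarrow> 'p set set" where
  "grassmannian \<Pi> k = {S. singular_subspace \<Pi> S \<and> has_dim \<Pi> S k}"

definition grassmannian_in :: "'p geometry \<Rightarrow> 'p set \<Rightarrow> int \<Rightarrow> 'p set set" where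
  "grassmannian_in \<Pi> U k = {S \<in> grassmannian \<Pi> k. S \<subseteq> U}"

record 'v graph =
  verts :: "'v set"
  adj :: "('v \<times> 'v) set"

definition polar_grassmann_graph :: "'p geometry \<Rightarrow> int \<Rightarrow> 'p set graph" where
  "polar_grassmann_graph \<Pi> k =
     \<lparr>verts = grassmannian \<Pi> k,
      adj = {(S, T). S \<in> grassmannian \<Pi> k \<and> T \<in> grassmannian \<Pi> k \<and> S \<noteq> T \<and>
                     (\<exists>W\<in>grassmannian \<Pi> (k + 1). S \<subseteq> W \<and> T \<subseteq> W)}\<rparr>"

text \<open>The parameter \<open>l\<close> is the rank of the polar space.\<close>

definition dual_polar_graph :: "'p geometry \<Rightarrow> nat \<Rightarrow> 'p set graph" where
  "dual_polar_graph \<Pi> l =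
     \<lparr>verts = {M. maximal_singular \<Pi> M},
      adj = {(M, N). maximal_singular \<Pi> M \<and> maximal_singular \<Pi> N \<and>
                     has_dim \<Pi> (M \<inter> N) (int l - 2)}\<rparr>"

text \<open>Graph distance, with value \<open>\<infinity>\<close> for vertices in different components.\<close>

definition graph_dist :: "'v graph \<Rightarrow> 'v \<Rightarrow> 'v \<Rightarrow> enat" where
  "graph_dist G x y = (INF m\<in>{m. (x, y) \<in> adj G ^^ m}. enat m)"

definition graph_embedding :: "'v graph \<Rightarrow> 'w graph \<Rightarrow> ('v \<Rightarrow> 'w) \<Rightarrow> bool" where
  "graph_embedding G H f \<longleftrightarrow> f ` verts G \<subseteq> verts H \<and> inj_on f (verts G) \<and>
     (\<forall>x\<in>verts G. \<forall>y\<in>verts G. (x, y) \<in> adj G \<longleftrightarrow> (f x, f y) \<in> adj H)"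

definition m_embedding :: "nat \<Rightarrow> 'v graph \<Rightarrow> 'w graph \<Rightarrow> ('v \<Rightarrow> 'w) \<Rightarrow> bool" where
  "m_embedding m G H f \<longleftrightarrow> graph_embedding G H f \<and>
     (\<forall>x\<in>verts G. \<forall>y\<in>verts G. graph_dist G x y \<le> enat m \<longrightarrow>
        graph_dist H (f x) (f y) = graph_dist G x y)"

end

theory Submission
  imports Defs
begin

text \<open>Let \<open>M\<close>, \<open>N\<close> be vertices at distance 2 in the dual polar graph. They have at least two common
  neighbours, so if \<open>f M\<close> and \<open>f N\<close> are not perpendicular then all common neighbours of \<open>M\<close>, \<open>N\<close>
  are mapped to elements through the same hyperplane \<open>Z\<close> of \<open>f M\<close> and of \<open>f N\<close>. The elements
  through \<open>Z\<close> are pairwise at distance at most 2, so \<open>f X\<close> cannot contain \<open>Z\<close> when \<open>X\<close> is at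
  distance 3 from a vertex mapped into the star of \<open>Z\<close>. Take \<open>X\<close> adjacent to \<open>M\<close> and at distance 3
  from \<open>N\<close>, and \<open>K\<close> adjacent to \<open>X\<close> and to a common neighbour of \<open>M\<close>, \<open>N\<close>. Then \<open>f K\<close> is
  perpendicular to \<open>f M\<close> and \<open>f N\<close>, a point of \<open>f K \<inter> f X\<close> outside \<open>f M\<close> together with \<open>Z\<close> spans a
  common neighbour of \<open>f X\<close> and \<open>f N\<close>, and this contradicts the preservation of distance 3.

  Hence vertices at distance 2 have perpendicular images. If \<open>X\<close> and \<open>Y\<close> are further apart, \<open>Y\<close> has
  two neighbours at distance 2 from each other that are closer to \<open>X\<close>; their images meet \<open>f Y\<close> in
  distinct hyperplanes, which span \<open>f Y\<close>. By induction all images are mutually perpendicular and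
  generate a singular subspace, and a pair at distance 3 bounds the rank from below.

  The projective structure of singular subspaces comes from double perps: for a singular subspace
  \<open>H\<close> and a point \<open>p\<close> perpendicular to \<open>H\<close> but outside it, \<open>H\<close> meets every line of the double perp of
  \<open>H \<union> {p}\<close>.\<close>

section \<open>Perpendicularity\<close>

definition perp :: "'p geometry \<Rightarrow> 'p set \<Rightarrow> 'p set" where
  "perp \<Pi> A = {x \<in> points \<Pi>. \<forall>a\<in>A. collinear \<Pi> x a}"

text \<open>In a projective space these are the proper subspaces meeting every line. The condition
  presupposes no dimension theory and makes the empty set a hyperplane of a single point.\<close>

definition hyperplane :: "'p geometry \<Rightarrow> 'p set \<Rightarrow> 'p set \<Rightarrow> bool" where
  "hyperplane \<Pi> H S \<longleftrightarrow> singular_subspace \<Pi> S \<and> subspace \<Pi> H \<and> H \<subset> S \<and>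
     (\<forall>L\<in>lines \<Pi>. L \<subseteq> S \<longrightarrow> L \<inter> H \<noteq> {})"

inductive flag :: "'p geometry \<Rightarrow> 'p set \<Rightarrow> nat \<Rightarrow> bool" for \<Pi> where
  flag_empty: "flag \<Pi> {} 0"
| flag_Suc: "flag \<Pi> H n \<Longrightarrow> hyperplane \<Pi> H S \<Longrightarrow> flag \<Pi> S (Suc n)"

text \<open>Projective dimension plus one, so the empty set has rank 0. The description is justified
  by \<open>flag_unique\<close> and, in a polar space, by \<open>flag_exists\<close>.\<close>

definition rk :: "'p geometry \<Rightarrow> 'p set \<Rightarrow> nat" where
  "rk \<Pi> S = (THE n. flag \<Pi> S n)"

text \<open>For non-collinear \<open>r\<close> and \<open>s\<close> this is a model of the residue of \<open>r\<close> that
  needs no planes: every line through \<open>r\<close> has exactly one point collinear with \<open>s\<close>.\<close>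

definition residue :: "'p geometry \<Rightarrow> 'p \<Rightarrow> 'p \<Rightarrow> 'p geometry" where
  "residue \<Pi> r s = \<lparr>points = perp \<Pi> {r, s}, lines = {L \<in> lines \<Pi>. L \<subseteq> perp \<Pi> {r, s}}\<rparr>"

text \<open>These axioms pass to residues (\<open>residue_weak_polar\<close>), so an induction may
  replace the geometry by a residue. Finiteness of chains is added in \<open>polar\<close>.\<close>

locale weak_polar =
  fixes \<Pi> :: "'p geometry"
  assumes line_points: "L \<in> lines \<Pi> \<Longrightarrow> L \<subseteq> points \<Pi>"
    and line_two: "L \<in> lines \<Pi> \<Longrightarrow> \<exists>p\<in>L. \<exists>q\<in>L. p \<noteq> q"
    and line_unique: "\<lbrakk>L \<in> lines \<Pi>; M \<in> lines \<Pi>; p \<noteq> q; p \<in> L; q \<in> L; p \<in> M; q \<in> M\<rbrakk> \<Longrightarrow> L = M"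
    and one_or_all: "\<lbrakk>p \<in> points \<Pi>; L \<in> lines \<Pi>\<rbrakk> \<Longrightarrow>
      (\<exists>!q. q \<in> L \<and> collinear \<Pi> p q) \<or> (\<forall>q\<in>L. collinear \<Pi> p q)"
    and nondegenerate: "p \<in> points \<Pi> \<Longrightarrow> \<exists>q\<in>points \<Pi>. \<not> collinear \<Pi> p q"
begin

abbreviation "col \<equiv> collinear \<Pi>"

lemma col_sym: "col x y \<Longrightarrow> col y x"
  unfolding collinear_def by blast

lemma col_refl: "x \<in> points \<Pi> \<Longrightarrow> col x x"
  unfolding collinear_def by blast

lemma col_points: "col x y \<Longrightarrow> x \<in> points \<Pi> \<and> y \<in> points \<Pi>"
  unfolding collinear_def by blast

lemma col_line: "\<lbrakk>col x y; x \<noteq> y\<rbrakk> \<Longrightarrow> \<exists>L\<in>lines \<Pi>. x \<in> L \<and> y \<in> L"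
  unfolding collinear_def by blast

lemma line_col: "\<lbrakk>L \<in> lines \<Pi>; x \<in> L; y \<in> L\<rbrakk> \<Longrightarrow> col x y"
  using line_points unfolding collinear_def by blast

lemma col_on_line:
  "\<lbrakk>L \<in> lines \<Pi>; a \<in> L; b \<in> L; a \<noteq> b; col x a; col x b; c \<in> L\<rbrakk> \<Longrightarrow> col x c"
  using one_or_all[of x L] col_points by blast

lemma meets_line: "\<lbrakk>x \<in> points \<Pi>; L \<in> lines \<Pi>\<rbrakk> \<Longrightarrow> \<exists>q\<in>L. col x q"
  using one_or_all[of x L] line_two[of L] by blast

lemma perp_points: "perp \<Pi> A \<subseteq> points \<Pi>"
  unfolding perp_def by blast

lemma perp_anti: "A \<subseteq> B \<Longrightarrow> perp \<Pi> B \<subseteq> perp \<Pi> A"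
  unfolding perp_def by blast

lemma perp_swap: "A \<subseteq> points \<Pi> \<Longrightarrow> B \<subseteq> perp \<Pi> A \<Longrightarrow> A \<subseteq> perp \<Pi> B"
  unfolding perp_def using col_sym by blast

lemma subspaceD:
  "\<lbrakk>subspace \<Pi> S; x \<in> S; y \<in> S; x \<noteq> y; L \<in> lines \<Pi>; x \<in> L; y \<in> L; z \<in> L\<rbrakk> \<Longrightarrow> z \<in> S"
  unfolding subspace_def by (meson subsetD)

lemma subspace_points: "subspace \<Pi> S \<Longrightarrow> S \<subseteq> points \<Pi>"
  unfolding subspace_def by (rule conjunct1)

lemma subspaceI:
  assumes "S \<subseteq> points \<Pi>"
    and "\<And>L x y z. \<lbrakk>L \<in> lines \<Pi>; x \<in> S; y \<in> S; x \<noteq> y; x \<in> L; y \<in> L; z \<in> L\<rbrakk> \<Longrightarrow> z \<in> S"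
  shows "subspace \<Pi> S"
  unfolding subspace_def using assms by (meson subsetI)

lemma subspace_perp: "subspace \<Pi> (perp \<Pi> A)"
proof (rule subspaceI)
  fix L x y z assume *: "L \<in> lines \<Pi>" "x \<in> perp \<Pi> A" "y \<in> perp \<Pi> A" "x \<noteq> y" "x \<in> L" "y \<in> L" "z \<in> L"
  then have "col z a" if "a \<in> A" for a
    using col_on_line[OF *(1,5,6,4) _ _ *(7), of a] that col_sym unfolding perp_def by simp
  then show "z \<in> perp \<Pi> A" using * line_points unfolding perp_def by blast
qed (rule perp_points)

lemma subspace_inter:
  assumes "subspace \<Pi> A" "subspace \<Pi> B"
  shows "subspace \<Pi> (A \<inter> B)"
proof (rule subspaceI)
  show "A \<inter> B \<subseteq> points \<Pi>" using subspace_points[OF assms(1)] by (simp add: le_infI1)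
  show "z \<in> A \<inter> B" if "L \<in> lines \<Pi>" "x \<in> A \<inter> B" "y \<in> A \<inter> B" "x \<noteq> y" "x \<in> L" "y \<in> L" "z \<in> L"
    for L x y z
    using that subspaceD[OF assms(1), of x y L z] subspaceD[OF assms(2), of x y L z] by simp
qed

lemma singular_sub: "\<lbrakk>singular_subspace \<Pi> S; subspace \<Pi> A; A \<subseteq> S\<rbrakk> \<Longrightarrow> singular_subspace \<Pi> A"
  unfolding singular_subspace_def by blast

lemma singular_inter: "\<lbrakk>singular_subspace \<Pi> S; subspace \<Pi> A\<rbrakk> \<Longrightarrow> singular_subspace \<Pi> (S \<inter> A)"
  unfolding singular_subspace_def by (simp add: subspace_inter)

lemma singular_subspaceD: "singular_subspace \<Pi> S \<Longrightarrow> subspace \<Pi> S"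
  unfolding singular_subspace_def by blast

lemma singular_points: "singular_subspace \<Pi> S \<Longrightarrow> S \<subseteq> points \<Pi>"
  unfolding singular_subspace_def by (simp add: subspace_points)

lemma singular_perp: "singular_subspace \<Pi> S \<Longrightarrow> S \<subseteq> perp \<Pi> S"
  unfolding singular_subspace_def perp_def collinear_def by blast

lemma singularI: "\<lbrakk>subspace \<Pi> S; S \<subseteq> perp \<Pi> S\<rbrakk> \<Longrightarrow> singular_subspace \<Pi> S"
  unfolding singular_subspace_def perp_def by blast

lemma singular_col: "\<lbrakk>singular_subspace \<Pi> S; x \<in> S; y \<in> S\<rbrakk> \<Longrightarrow> col x y"
  unfolding singular_subspace_def by blast

lemma singular_line:
  assumes "singular_subspace \<Pi> S" "x \<in> S" "y \<in> S" "x \<noteq> y"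
  obtains L where "L \<in> lines \<Pi>" "x \<in> L" "y \<in> L" "L \<subseteq> S"
proof -
  obtain L where L: "L \<in> lines \<Pi>" "x \<in> L" "y \<in> L"
    using col_line assms unfolding singular_subspace_def by metis
  then have "L \<subseteq> S"
    using subspaceD[OF _ assms(2-4)] assms(1) unfolding singular_subspace_def by blast
  then show ?thesis using that L by blast
qed

lemma singular_empty: "singular_subspace \<Pi> {}"
  unfolding singular_subspace_def subspace_def by blast

section \<open>Hyperplanes and rank\<close>

lemma hyperplane_singular: "hyperplane \<Pi> H S \<Longrightarrow> singular_subspace \<Pi> H \<and> singular_subspace \<Pi> S"
  unfolding hyperplane_def using singular_sub by blast

lemma hyperplane_psubset: "hyperplane \<Pi> H S \<Longrightarrow> H \<subset> S"
  unfolding hyperplane_def by blast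

text \<open>The line from \<open>s\<close> to another point of \<open>S\<close> meets
  \<open>H\<close> in a point other than \<open>s\<close>; two of its points lie in
  \<open>W\<close>, hence all of them.\<close>

lemma hyperplane_generates:
  assumes "hyperplane \<Pi> H S" "s \<in> S" "s \<notin> H" "subspace \<Pi> W" "H \<subseteq> W" "s \<in> W"
  shows "S \<subseteq> W"
proof
  fix x assume x: "x \<in> S"
  show "x \<in> W"
  proof (cases "x = s")
    case False
    have "singular_subspace \<Pi> S" using assms(1) unfolding hyperplane_def by simp
    then obtain L where L: "L \<in> lines \<Pi>" "x \<in> L" "s \<in> L" "L \<subseteq> S"
      using singular_line[of S x s] x assms(2) False by metis
    moreover have "L \<inter> H \<noteq> {}" using assms(1) L unfolding hyperplane_def by simp
    then obtain h where h: "h \<in> L" "h \<in> H" by blast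
    have "h \<noteq> s" "h \<in> W" using h assms by auto
    then show ?thesis using subspaceD[OF assms(4) _ assms(6)] L h by blast
  qed (use assms in simp)
qed

lemma hyperplane_maximal:
  assumes "hyperplane \<Pi> H S" "subspace \<Pi> W" "H \<subseteq> W" "W \<subset> S"
  shows "W = H"
  using assms hyperplane_generates by blast

lemma hyperplane_inter:
  assumes "hyperplane \<Pi> H S" "subspace \<Pi> T" "T \<subseteq> S" "\<not> T \<subseteq> H"
  shows "hyperplane \<Pi> (T \<inter> H) T"
proof -
  have h: "singular_subspace \<Pi> S" "subspace \<Pi> H"
    "\<And>L. L \<in> lines \<Pi> \<Longrightarrow> L \<subseteq> S \<Longrightarrow> L \<inter> H \<noteq> {}"
    using assms(1) unfolding hyperplane_def by auto
  have "L \<inter> (T \<inter> H) \<noteq> {}" if "L \<in> lines \<Pi>" "L \<subseteq> T" for L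
    using h(3)[of L] that assms(3) by auto
  moreover have "T \<inter> H \<subset> T" using assms(4) by auto
  ultimately show ?thesis
    using singular_sub[OF h(1) assms(2,3)] subspace_inter[OF assms(2) h(2)]
    unfolding hyperplane_def by simp
qed

text \<open>By one-or-all, \<open>s\<close> is collinear with some point of every line of
  \<open>S\<close>.\<close>

lemma hyperplane_perp:
  assumes "singular_subspace \<Pi> S" "s \<in> points \<Pi>" "\<not> S \<subseteq> perp \<Pi> {s}"
  shows "hyperplane \<Pi> (S \<inter> perp \<Pi> {s}) S"
proof -
  have "L \<inter> (S \<inter> perp \<Pi> {s}) \<noteq> {}" if "L \<in> lines \<Pi>" "L \<subseteq> S" for L
    using meets_line[OF assms(2) that(1)] that line_points[OF that(1)] col_sym
    unfolding perp_def by blast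
  then show ?thesis
    using assms subspace_inter[OF singular_subspaceD[OF assms(1)] subspace_perp[of "{s}"]]
    unfolding hyperplane_def by blast
qed

lemma flag_singular: "flag \<Pi> S n \<Longrightarrow> singular_subspace \<Pi> S"
  by (induction rule: flag.induct) (auto simp: singular_empty hyperplane_singular)

text \<open>Exchange as in the Jordan-Hoelder theorem: two distinct hyperplanes of \<open>S\<close>
  meet in a common hyperplane, through which flags of both can be compared.\<close>

lemma flag_hyperplane:
  "\<lbrakk>flag \<Pi> S n; hyperplane \<Pi> H S\<rbrakk> \<Longrightarrow> \<exists>m. n = Suc m \<and> flag \<Pi> H m"
proof (induction arbitrary: H rule: flag.induct)
  case flag_empty
  then show ?case using hyperplane_psubset by blast
next
  case (flag_Suc H' n S)
  show ?case
  proof (cases "H = H'")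
    case True
    then show ?thesis using flag_Suc by blast
  next
    case False
    have sub: "subspace \<Pi> H" "subspace \<Pi> H'"
      using flag_Suc unfolding hyperplane_def by blast+
    have ss: "H \<subset> S" "H' \<subset> S" using flag_Suc.prems flag_Suc.hyps hyperplane_psubset by blast+
    have "\<not> H \<subseteq> H'" "\<not> H' \<subseteq> H"
      using False hyperplane_maximal[OF flag_Suc.prems sub(2)]
        hyperplane_maximal[OF flag_Suc.hyps(2) sub(1)] ss by blast+
    then have "hyperplane \<Pi> (H' \<inter> H) H'" "hyperplane \<Pi> (H \<inter> H') H"
      using hyperplane_inter flag_Suc sub ss by blast+
    then show ?thesis using flag_Suc.IH flag.flag_Suc by (metis inf_commute)
  qed
qed

lemma flag_unique: "flag \<Pi> S n \<Longrightarrow> flag \<Pi> S m \<Longrightarrow> n = m"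
proof (induction arbitrary: m rule: flag.induct)
  case flag_empty
  then show ?case by cases (auto simp: hyperplane_def)
next
  case (flag_Suc H n S)
  then show ?case using flag_hyperplane by blast
qed

lemma rk_flag: "flag \<Pi> S n \<Longrightarrow> rk \<Pi> S = n"
  unfolding rk_def using flag_unique by blast

section \<open>Double perps of singular subspaces\<close>

text \<open>If every point collinear with \<open>a\<close> were collinear with \<open>p\<close>, a
  third point \<open>t\<close> of the line through \<open>a\<close> and \<open>p\<close> would be
  collinear with all points, against nondegeneracy.\<close>

lemma col_separates:
  assumes "a \<in> points \<Pi>" "p \<in> points \<Pi>" "a \<noteq> p"
  shows "\<exists>q. col q a \<and> \<not> col q p"
proof (rule ccontr)
  assume "\<not> ?thesis"
  then have ap: "col q p" if "col q a" for q using that by blast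
  obtain y where y: "y \<in> points \<Pi>" "\<not> col p y" using nondegenerate assms by blast
  have "col a p" using ap col_refl assms by blast
  then obtain L where L: "L \<in> lines \<Pi>" "a \<in> L" "p \<in> L" using col_line assms by blast
  obtain t where t: "t \<in> L" "col y t" using meets_line y L by blast
  have ta: "t \<noteq> a" and tp: "t \<noteq> p" and ty: "t \<noteq> y"
    using y t ap col_sym line_col[OF L(1) L(3)] by metis+
  obtain M where M: "M \<in> lines \<Pi>" "t \<in> M" "y \<in> M" using col_line[OF t(2)] ty by metis
  \<comment> \<open>Project \<open>w\<close> to \<open>y1\<close> on the line \<open>M\<close>
    through \<open>t\<close> and \<open>y\<close>, then \<open>a\<close> to \<open>e\<close> on the
    line \<open>N\<close> through \<open>w\<close> and \<open>y1\<close>. Being collinear with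
    \<open>a\<close>, the point \<open>e\<close> is collinear with \<open>p\<close> and so with
    \<open>t\<close>; thus \<open>t\<close> is collinear with two points of \<open>N\<close>, hence
    with \<open>w\<close>.\<close>
  have "col w t" if w: "w \<in> points \<Pi>" for w
  proof (rule ccontr)
    assume wt: "\<not> col w t"
    have wa: "\<not> col w a" using ap wt col_on_line[OF L(1) L(2,3) assms(3)] t by blast
    obtain y1 where y1: "y1 \<in> M" "col w y1" using meets_line w M by blast
    have y1t: "y1 \<noteq> t" using y1 wt by blast
    have wy: "w \<noteq> y1" using wt y1 line_col M by blast
    have y1a: "\<not> col y1 a"
      using col_on_line[OF M(1,2) y1(1), of a y] y1t ap y col_sym line_col[OF L(1)] t L M by metis
    obtain N where N: "N \<in> lines \<Pi>" "w \<in> N" "y1 \<in> N" using col_line y1 wy by blast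
    obtain e where e: "e \<in> N" "col a e" using meets_line assms N by blast
    have "e \<noteq> y1" using e y1a col_sym by blast
    have "col e t" using ap[of e] e col_sym col_on_line[OF L(1) L(2,3) assms(3)] t by blast
    then have "col t w"
      using col_on_line[OF N(1) e(1) N(3) \<open>e \<noteq> y1\<close>] N col_sym line_col M y1 by blast
    then show False using wt col_sym by blast
  qed
  moreover have "t \<in> points \<Pi>" using t col_points by blast
  ultimately show False using nondegenerate col_sym by blast
qed

section \<open>Residues of a point\<close>

lemma line_to_perp:
  assumes "\<not> col r s" "s \<in> points \<Pi>" "col r x" "x \<noteq> r"
  obtains x' L where "x' \<in> perp \<Pi> {r, s}" "L \<in> lines \<Pi>" "r \<in> L" "x \<in> L" "x' \<in> L" "x' \<noteq> r"
proof -
  obtain L where L: "L \<in> lines \<Pi>" "r \<in> L" "x \<in> L" using col_line assms by metis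
  obtain x' where x': "x' \<in> L" "col s x'" using meets_line assms L by blast
  have "x' \<noteq> r" using x' assms col_sym by blast
  moreover have "x' \<in> perp \<Pi> {r, s}"
    using x' L col_sym line_col col_points unfolding perp_def by blast
  ultimately show ?thesis using that L x' by blast
qed

lemma residue_col:
  assumes "x \<in> perp \<Pi> {r, s}" "y \<in> perp \<Pi> {r, s}"
  shows "collinear (residue \<Pi> r s) x y \<longleftrightarrow> col x y"
proof -
  have "L \<subseteq> perp \<Pi> {r, s}" if "x \<noteq> y" "L \<in> lines \<Pi>" "x \<in> L" "y \<in> L" for L
    using that subspaceD[OF subspace_perp assms] by blast
  then have "(\<exists>L\<in>{L \<in> lines \<Pi>. L \<subseteq> perp \<Pi> {r, s}}. x \<in> L \<and> y \<in> L)
      \<longleftrightarrow> (\<exists>L\<in>lines \<Pi>. x \<in> L \<and> y \<in> L)" if "x \<noteq> y"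
    using that by (metis (no_types, lifting) mem_Collect_eq)
  moreover have "x \<in> points \<Pi>" "y \<in> points \<Pi>" using assms perp_points by auto
  ultimately show ?thesis using assms unfolding collinear_def residue_def by auto
qed

text \<open>Nondegeneracy rests on \<open>col_separates\<close>: a point collinear with
  \<open>r\<close> but not with \<open>p\<close> is moved along its line through \<open>r\<close>
  into the residue. It stays non-collinear with \<open>p\<close>, because \<open>p\<close> is
  collinear with \<open>r\<close>.\<close>

lemma residue_weak_polar:
  assumes "\<not> col r s" "r \<in> points \<Pi>" "s \<in> points \<Pi>"
  shows "weak_polar (residue \<Pi> r s)"
proof
  have lin: "L \<in> lines (residue \<Pi> r s) \<longleftrightarrow> L \<in> lines \<Pi> \<and> L \<subseteq> perp \<Pi> {r, s}" for L
    unfolding residue_def by simp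
  have pt: "points (residue \<Pi> r s) = perp \<Pi> {r, s}" unfolding residue_def by simp
  show "L \<subseteq> points (residue \<Pi> r s)" if "L \<in> lines (residue \<Pi> r s)" for L
    using that lin pt by blast
  show "\<exists>p\<in>L. \<exists>q\<in>L. p \<noteq> q" if "L \<in> lines (residue \<Pi> r s)" for L
    using that lin line_two by blast
  show "L = M" if "L \<in> lines (residue \<Pi> r s)" "M \<in> lines (residue \<Pi> r s)" "p \<noteq> q"
    "p \<in> L" "q \<in> L" "p \<in> M" "q \<in> M" for L M p q
    using that lin line_unique by blast
  show "(\<exists>!q. q \<in> L \<and> collinear (residue \<Pi> r s) p q) \<or> (\<forall>q\<in>L. collinear (residue \<Pi> r s) p q)"
    if "p \<in> points (residue \<Pi> r s)" "L \<in> lines (residue \<Pi> r s)" for p L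
  proof -
    have "\<And>q. q \<in> L \<Longrightarrow> collinear (residue \<Pi> r s) p q \<longleftrightarrow> col p q"
      using residue_col that lin pt by blast
    then show ?thesis
      using one_or_all[of p L] that lin pt perp_points by (metis (no_types, lifting) subset_iff)
  qed
  show "\<exists>q\<in>points (residue \<Pi> r s). \<not> collinear (residue \<Pi> r s) p q"
    if p: "p \<in> points (residue \<Pi> r s)" for p
  proof -
    have pp: "col p r" "col p s" "p \<in> points \<Pi>" using p pt unfolding perp_def by auto
    have "p \<noteq> r" using assms pp by blast
    then obtain q where q: "col q r" "\<not> col q p" using col_separates assms pp by metis
    have "q \<noteq> r" using q pp col_sym by blast
    then obtain q' L where q': "q' \<in> perp \<Pi> {r, s}" "L \<in> lines \<Pi>" "r \<in> L" "q \<in> L" "q' \<in> L" "q' \<noteq> r"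
      using line_to_perp[of r s q] assms q col_sym by metis
    have "\<not> col p q'" using col_on_line[OF q'(2,3,5), of p q] q' q pp col_sym by blast
    then show ?thesis using residue_col q' p pt by blast
  qed
qed

lemma residue_subspace: "A \<subseteq> perp \<Pi> {r, s} \<Longrightarrow> subspace \<Pi> A \<Longrightarrow> subspace (residue \<Pi> r s) A"
  unfolding subspace_def residue_def by simp

lemma residue_singular:
  assumes "A \<subseteq> perp \<Pi> {r, s}" "singular_subspace \<Pi> A"
  shows "singular_subspace (residue \<Pi> r s) A"
  using assms residue_subspace residue_col unfolding singular_subspace_def by (meson subsetD)

lemma residue_flag: "flag \<Pi> A n \<Longrightarrow> A \<subseteq> perp \<Pi> {r, s} \<Longrightarrow> flag (residue \<Pi> r s) A n"
proof (induction rule: flag.induct)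
  case (flag_Suc H n S)
  then have "hyperplane (residue \<Pi> r s) H S"
    using residue_subspace[of H r s] residue_singular[of S r s]
    unfolding hyperplane_def by (auto simp: residue_def)
  then show ?case using flag_Suc hyperplane_psubset flag.flag_Suc by blast
qed (simp add: flag.flag_empty)

end

text \<open>Says that no point outside \<open>H\<close> lies in the double perp of \<open>H\<close>.
  The induction passes to the residue of a point of \<open>H\<close>, which lowers the rank by one
  and changes the geometry; hence the statement outside the locale. Rank 0 is nondegeneracy.\<close>

lemma flag_separates:
  assumes "weak_polar \<Pi>" "flag \<Pi> H n" "p \<in> points \<Pi>" "p \<notin> H" "H \<subseteq> perp \<Pi> {p}"
  shows "\<exists>q\<in>perp \<Pi> H. \<not> collinear \<Pi> q p"
  using assms
proof (induction n arbitrary: \<Pi> H p)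
  case 0
  interpret weak_polar \<Pi> by fact
  have "H = {}" using 0(2) by cases auto
  then show ?case using nondegenerate[OF 0(3)] col_sym unfolding perp_def by blast
next
  case (Suc n)
  interpret weak_polar \<Pi> by fact
  have sing: "singular_subspace \<Pi> H" using flag_singular Suc by blast
  obtain H0 where "hyperplane \<Pi> H0 H" using Suc(3) by cases auto
  then obtain r where r: "r \<in> H" using hyperplane_psubset by blast
  then have rp: "r \<in> points \<Pi>" using sing singular_points by blast
  \<comment> \<open>In the residue of \<open>r\<close>, the hyperplane \<open>?H\<close> represents
    \<open>H\<close>, and the point \<open>p'\<close> on the line through \<open>r\<close> and
    \<open>p\<close> represents \<open>p\<close>.\<close>
  then obtain s where s: "s \<in> points \<Pi>" "\<not> col r s" using nondegenerate by blast
  let ?H = "H \<inter> perp \<Pi> {s}"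
  have "\<not> H \<subseteq> perp \<Pi> {s}" using r s unfolding perp_def by blast
  then have hyp: "hyperplane \<Pi> ?H H" using hyperplane_perp sing s by blast
  then have fl: "flag \<Pi> ?H n" using flag_hyperplane Suc(3) by blast
  have sub: "?H \<subseteq> perp \<Pi> {r, s}"
    using singular_perp[OF sing] r unfolding perp_def by blast
  have rcp: "col r p" using Suc.prems(5) r unfolding perp_def by blast
  obtain p' L where p': "p' \<in> perp \<Pi> {r, s}" "L \<in> lines \<Pi>" "r \<in> L" "p \<in> L" "p' \<in> L" "p' \<noteq> r"
    using line_to_perp[OF s(2,1) rcp] Suc.prems(4) r by metis
  have HL: "h \<in> perp \<Pi> {p'}" if "h \<in> H" for h
    using that col_on_line[OF p'(2,3,4)] p' Suc.prems(4,5) r singular_col[OF sing]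
    unfolding perp_def by blast
  have "p' \<notin> ?H"
    using p' r Suc.prems(4) subspaceD[OF singular_subspaceD[OF sing], of p' r L p] by blast
  moreover have "?H \<subseteq> perp (residue \<Pi> r s) {p'}"
    using HL sub residue_col p'(1) unfolding perp_def residue_def by fastforce
  ultimately obtain q where q: "q \<in> perp (residue \<Pi> r s) ?H" "\<not> collinear (residue \<Pi> r s) q p'"
    using Suc.IH[OF residue_weak_polar[OF s(2) rp s(1)] residue_flag[OF fl sub], of p'] p'(1)
    by (auto simp: residue_def)
  have q1: "q \<in> perp \<Pi> {r, s}" using q unfolding perp_def residue_def by auto
  have q2: "\<not> col q p'" using q residue_col q1 p' by blast
  have "?H \<subseteq> perp \<Pi> {q}"
  proof
    fix h assume h: "h \<in> ?H"
    then have "collinear (residue \<Pi> r s) q h" using q(1) unfolding perp_def by blast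
    then have "col h q" using residue_col[OF q1] sub h col_sym by blast
    then show "h \<in> perp \<Pi> {q}" using col_points unfolding perp_def by blast
  qed
  moreover have "r \<in> perp \<Pi> {q}" using q1 rp col_sym unfolding perp_def by blast
  moreover have "r \<notin> ?H" using s unfolding perp_def by blast
  ultimately have "H \<subseteq> perp \<Pi> {q}"
    using hyperplane_generates[OF hyp r _ subspace_perp] by blast
  then have "q \<in> perp \<Pi> H" using q1 col_sym unfolding perp_def by blast
  \<comment> \<open>A point collinear with both \<open>r\<close> and \<open>p\<close> would be
    collinear with \<open>p'\<close>.\<close>
  moreover have "\<not> col q p"
    using col_on_line[OF p'(2,3,4)] p' q2 Suc.prems(4) r q1 unfolding perp_def by blast
  ultimately show ?case by blast
qed

section \<open>Finite chains and the existence of ranks\<close>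

lemma maximal_of_finite_chains:
  assumes "F \<noteq> {}" "\<And>C. C \<subseteq> F \<Longrightarrow> \<forall>S\<in>C. \<forall>T\<in>C. S \<subseteq> T \<or> T \<subseteq> S \<Longrightarrow> finite C"
  shows "\<exists>M\<in>F. \<forall>S\<in>F. M \<subseteq> S \<longrightarrow> S = M"
proof (rule subset_Zorn_nonempty[OF assms(1)])
  fix C assume C: "C \<noteq> {}" "subset.chain F C"
  then have "C \<subseteq> F" "\<forall>S\<in>C. \<forall>T\<in>C. S \<subseteq> T \<or> T \<subseteq> S" by (auto simp: subset_chain_def)
  \<comment> \<open>A nonempty finite chain contains its own union.\<close>
  then show "\<Union> C \<in> F" using Union_in_chain[OF assms(2) C] by blast
qed

locale polar = weak_polar +
  assumes finite_chain:
    "\<lbrakk>\<forall>S\<in>C. singular_subspace \<Pi> S; \<forall>S\<in>C. \<forall>T\<in>C. S \<subseteq> T \<or> T \<subseteq> S\<rbrakk> \<Longrightarrow> finite C"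
begin

lemma maximal_member:
  assumes "F \<noteq> {}" "\<And>S. S \<in> F \<Longrightarrow> singular_subspace \<Pi> S"
  obtains M where "M \<in> F" "\<And>S. S \<in> F \<Longrightarrow> M \<subseteq> S \<Longrightarrow> S = M"
proof -
  have "\<exists>M\<in>F. \<forall>S\<in>F. M \<subseteq> S \<longrightarrow> S = M"
  proof (rule maximal_of_finite_chains[OF assms(1)])
    fix C assume C: "C \<subseteq> F" "\<forall>S\<in>C. \<forall>T\<in>C. S \<subseteq> T \<or> T \<subseteq> S"
    have "\<forall>S\<in>C. singular_subspace \<Pi> S" using C(1) assms(2) by auto
    then show "finite C" using C(2) by (rule finite_chain)
  qed
  then show ?thesis using that by blast
qed

lemma minimal_member:
  assumes "F \<noteq> {}" "\<And>S. S \<in> F \<Longrightarrow> singular_subspace \<Pi> S"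
  obtains M where "M \<in> F" "\<And>S. S \<in> F \<Longrightarrow> S \<subseteq> M \<Longrightarrow> S = M"
proof -
  \<comment> \<open>Complements exchange minimal and maximal members.\<close>
  have "\<exists>M\<in>uminus ` F. \<forall>S\<in>uminus ` F. M \<subseteq> S \<longrightarrow> S = M"
  proof (rule maximal_of_finite_chains)
    fix C assume C: "C \<subseteq> uminus ` F" "\<forall>S\<in>C. \<forall>T\<in>C. S \<subseteq> T \<or> T \<subseteq> S"
    have "\<forall>S\<in>uminus ` C. singular_subspace \<Pi> S" using C(1) assms(2) by force
    moreover have "\<forall>S\<in>uminus ` C. \<forall>T\<in>uminus ` C. S \<subseteq> T \<or> T \<subseteq> S" using C(2) by fastforce
    ultimately have "finite (uminus ` C)" by (rule finite_chain)
    then show "finite C" by (rule finite_imageD) (simp add: inj_on_def)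
  qed (use assms in simp)
  then obtain N where N: "N \<in> uminus ` F" "\<And>S. S \<in> uminus ` F \<Longrightarrow> N \<subseteq> S \<Longrightarrow> S = N" by auto
  have "- N \<in> F" using N(1) by auto
  moreover have "S = - N" if "S \<in> F" "S \<subseteq> - N" for S
    using N(2)[of "- S"] that by auto
  ultimately show ?thesis using that by simp
qed

text \<open>A minimal counterexample is nonempty, so the perp of some point cuts it in a hyperplane;
  that hyperplane has a flag, which then extends.\<close>

lemma flag_exists:
  assumes "singular_subspace \<Pi> S"
  shows "flag \<Pi> S (rk \<Pi> S)"
proof -
  have "\<exists>n. flag \<Pi> S n"
  proof (rule ccontr)
    let ?F = "{S. singular_subspace \<Pi> S \<and> (\<nexists>n. flag \<Pi> S n)}"
    assume "\<nexists>n. flag \<Pi> S n"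
    then have "?F \<noteq> {}" using assms by blast
    then obtain M where M: "M \<in> ?F" "\<And>S. S \<in> ?F \<Longrightarrow> S \<subseteq> M \<Longrightarrow> S = M"
      using minimal_member[of ?F] by blast
    have sing: "singular_subspace \<Pi> M" using M(1) by simp
    have "M \<noteq> {}" using M(1) flag_empty by blast
    then obtain r where r: "r \<in> M" by blast
    then obtain s where s: "s \<in> points \<Pi>" "\<not> col r s"
      using nondegenerate singular_points[OF sing] by blast
    then have "\<not> M \<subseteq> perp \<Pi> {s}" using r unfolding perp_def by blast
    then have h: "hyperplane \<Pi> (M \<inter> perp \<Pi> {s}) M" using hyperplane_perp[OF sing s(1)] by blast
    then have "M \<inter> perp \<Pi> {s} \<notin> ?F" using M(2) hyperplane_psubset by blast
    then obtain n where "flag \<Pi> (M \<inter> perp \<Pi> {s}) n" using hyperplane_singular[OF h] by blast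
    then show False using flag_Suc[OF _ h] M(1) by blast
  qed
  then show ?thesis using rk_flag by metis
qed

lemma rk_empty: "rk \<Pi> {} = 0"
  using rk_flag flag_empty by blast

lemma rk_hyperplane: "hyperplane \<Pi> H S \<Longrightarrow> rk \<Pi> S = Suc (rk \<Pi> H)"
  using rk_flag flag_Suc flag_exists hyperplane_singular by blast

text \<open>Compare with a hyperplane \<open>H\<close> of \<open>T\<close>. If \<open>S\<close> is
  not inside \<open>H\<close>, replacing \<open>S\<close> by \<open>S \<inter> H\<close> and
  \<open>T\<close> by \<open>H\<close> lowers both ranks by one, and the inclusion stays proper by
  maximality of \<open>H\<close>.\<close>

lemma rk_less:
  assumes "singular_subspace \<Pi> T" "subspace \<Pi> S" "S \<subset> T"
  shows "rk \<Pi> S < rk \<Pi> T"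
  using assms
proof (induction n \<equiv> "rk \<Pi> T" arbitrary: S T)
  case 0
  have "T = {}" using flag_exists[OF 0(2)] 0(1) by cases auto
  then show ?case using 0 by simp
next
  case (Suc n)
  have "\<exists>H. hyperplane \<Pi> H T" using flag_exists[OF Suc.prems(1)] Suc.hyps(2) by cases auto
  then obtain H where H: "hyperplane \<Pi> H T" by blast
  have rT: "rk \<Pi> T = Suc (rk \<Pi> H)" using rk_hyperplane H by blast
  have sH: "singular_subspace \<Pi> H" using hyperplane_singular H by blast
  have IH: "rk \<Pi> A < rk \<Pi> H" if "A \<subset> H" "subspace \<Pi> A" for A
    using Suc.hyps(1)[OF _ sH that(2,1)] Suc.hyps(2) rT by simp
  show ?case
  proof (cases "S \<subseteq> H")
    case True
    then consider "S = H" | "S \<subset> H" by blast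
    then show ?thesis using IH[OF _ Suc.prems(2)] rT by cases (simp, fastforce)
  next
    case False
    have h: "hyperplane \<Pi> (S \<inter> H) S"
      using hyperplane_inter[OF H Suc.prems(2) _ False] Suc.prems(3) by blast
    have "\<not> H \<subseteq> S" using hyperplane_maximal[OF H Suc.prems(2)] Suc.prems(3) False by blast
    then have "rk \<Pi> (S \<inter> H) < rk \<Pi> H"
      using IH subspace_inter[OF Suc.prems(2) singular_subspaceD[OF sH]] by blast
    then show ?thesis using rk_hyperplane[OF h] rT by simp
  qed
qed

lemma rk_mono: "\<lbrakk>singular_subspace \<Pi> T; subspace \<Pi> S; S \<subseteq> T\<rbrakk> \<Longrightarrow> rk \<Pi> S \<le> rk \<Pi> T"
  using rk_less[of T S] by (cases "S = T") (simp, metis psubsetI less_imp_le)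

lemma rk_eq: "\<lbrakk>singular_subspace \<Pi> T; subspace \<Pi> S; S \<subseteq> T; rk \<Pi> S = rk \<Pi> T\<rbrakk> \<Longrightarrow> S = T"
  using rk_less[of T S] by (metis psubsetI less_irrefl)

text \<open>The double perp serves as the generated subspace: it is visibly a subspace, and singular
  if the points of \<open>A\<close> are pairwise collinear.\<close>

definition join :: "'a set \<Rightarrow> 'a set" where
  "join A = perp \<Pi> (perp \<Pi> A)"

lemma subspace_join: "subspace \<Pi> (join A)"
  unfolding join_def by (rule subspace_perp)

lemma join_upper: "A \<subseteq> points \<Pi> \<Longrightarrow> A \<subseteq> join A"
  unfolding join_def by (rule perp_swap) auto

lemma join_singular: "A \<subseteq> perp \<Pi> A \<Longrightarrow> singular_subspace \<Pi> (join A)"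
proof (rule singularI[OF subspace_join])
  assume A: "A \<subseteq> perp \<Pi> A"
  then have "perp \<Pi> (perp \<Pi> A) \<subseteq> perp \<Pi> A" by (rule perp_anti)
  then show "join A \<subseteq> perp \<Pi> (join A)"
    unfolding join_def using perp_swap[OF perp_points] by blast
qed

text \<open>Choose \<open>q\<close> perpendicular to \<open>H\<close> but not collinear with
  \<open>p\<close>. Every line of the join has a point \<open>x\<close> collinear with
  \<open>q\<close>. If \<open>x\<close> were outside \<open>H\<close>, separating it from
  \<open>H\<close> in the residue of \<open>p\<close> would give a point \<open>u\<close>
  perpendicular to \<open>H\<close> and \<open>p\<close> but not collinear with \<open>x\<close>,
  although \<open>x\<close> lies in their double perp.\<close>

lemma hyperplane_join:
  assumes "singular_subspace \<Pi> H" "p \<in> perp \<Pi> H" "p \<notin> H"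
  shows "hyperplane \<Pi> H (join (insert p H))"
proof -
  have pt: "insert p H \<subseteq> points \<Pi>" using assms singular_points perp_points by blast
  have Hp: "H \<subseteq> perp \<Pi> {p}"
    using assms singular_points col_sym unfolding perp_def by blast
  have "insert p H \<subseteq> perp \<Pi> (insert p H)"
    using Hp assms(2) singular_perp[OF assms(1)] pt col_refl unfolding perp_def by auto
  then have sing: "singular_subspace \<Pi> (join (insert p H))" by (rule join_singular)
  obtain q where q: "q \<in> perp \<Pi> H" "\<not> col q p"
    using flag_separates[OF weak_polar_axioms flag_exists[OF assms(1)] _ assms(3) Hp] pt by blast
  have qp: "q \<in> points \<Pi>" "\<not> col p q" using q col_sym perp_points by blast+
  have Hpq: "H \<subseteq> perp \<Pi> {p, q}"
    using Hp q(1) col_sym pt unfolding perp_def by blast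
  have "L \<inter> H \<noteq> {}" if L: "L \<in> lines \<Pi>" "L \<subseteq> join (insert p H)" for L
  proof -
    obtain x where x: "x \<in> L" "col q x" using meets_line[OF qp(1) L(1)] by blast
    have xJ: "x \<in> join (insert p H)" using x L by blast
    have "x \<in> H"
    proof (rule ccontr)
      assume xH: "x \<notin> H"
      have ppJ: "p \<in> join (insert p H)" "H \<subseteq> join (insert p H)" using join_upper[OF pt] by blast+
      have xpq: "x \<in> perp \<Pi> {p, q}"
        using singular_col[OF sing xJ ppJ(1)] x col_sym col_points unfolding perp_def by blast
      interpret R: weak_polar "residue \<Pi> p q" using residue_weak_polar qp pt by blast
      have "H \<subseteq> perp (residue \<Pi> p q) {x}"
      proof
        fix h assume h: "h \<in> H"
        then have "col h x" using singular_col[OF sing _ xJ] ppJ by blast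
        then have "collinear (residue \<Pi> p q) h x" using residue_col xpq Hpq h by blast
        then show "h \<in> perp (residue \<Pi> p q) {x}" using R.col_points unfolding perp_def by blast
      qed
      then obtain u where u: "u \<in> perp (residue \<Pi> p q) H" "\<not> collinear (residue \<Pi> p q) u x"
        using flag_separates[OF R.weak_polar_axioms residue_flag[OF flag_exists[OF assms(1)] Hpq] _ xH] xpq
        by (auto simp: residue_def)
      have u1: "u \<in> perp \<Pi> {p, q}" using u(1) unfolding perp_def residue_def by simp
      have "\<not> col u x" using u(2) residue_col[OF u1 xpq] by simp
      moreover have "u \<in> perp \<Pi> (insert p H)"
      proof -
        have "col u h" if "h \<in> H" for h
          using u(1) residue_col[OF u1] Hpq that unfolding perp_def by blast
        then show ?thesis using u1 unfolding perp_def by blast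
      qed
      ultimately show False using xJ col_sym unfolding join_def perp_def by blast
    qed
    then show ?thesis using x by blast
  qed
  moreover have "H \<subset> join (insert p H)" using join_upper[OF pt] assms(3) by blast
  ultimately show ?thesis
    using sing singular_subspaceD[OF assms(1)] unfolding hyperplane_def by blast
qed

text \<open>\<open>H\<close> is a hyperplane of the join, so \<open>H\<close> and \<open>p\<close>
  generate it: in this case the double perp is the generated subspace.\<close>

lemma join_insert_least:
  assumes "singular_subspace \<Pi> H" "p \<in> perp \<Pi> H" "p \<notin> H" "subspace \<Pi> W" "H \<subseteq> W" "p \<in> W"
  shows "join (insert p H) \<subseteq> W"
proof -
  have "p \<in> join (insert p H)"
    using join_upper[of "insert p H"] assms(1,2) singular_points perp_points by blast
  then show ?thesis
    using hyperplane_generates[OF hyperplane_join[OF assms(1-3)] _ assms(3-6)] by blast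
qed

text \<open>The join of \<open>T\<close> with one further point of \<open>W\<close> already has the
  rank of \<open>W\<close> and so equals \<open>W\<close>. This turns a rank condition into the
  condition on lines.\<close>

lemma hyperplane_rkI:
  assumes "singular_subspace \<Pi> W" "subspace \<Pi> T" "T \<subseteq> W" "rk \<Pi> W = Suc (rk \<Pi> T)"
  shows "hyperplane \<Pi> T W"
proof -
  have T: "singular_subspace \<Pi> T" using singular_sub assms by blast
  have "T \<noteq> W" using assms by auto
  then obtain p where p: "p \<in> W" "p \<notin> T" using assms by blast
  have "p \<in> perp \<Pi> T" using singular_perp[OF assms(1)] p perp_anti[OF assms(3)] by blast
  then have h: "hyperplane \<Pi> T (join (insert p T))" "join (insert p T) \<subseteq> W"
    using hyperplane_join join_insert_least T p assms singular_subspaceD by blast+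
  then have "join (insert p T) = W"
    using rk_eq[OF assms(1) subspace_join] rk_hyperplane assms(4) by metis
  then show ?thesis using h by simp
qed

lemma maximal_exists:
  assumes "singular_subspace \<Pi> S"
  obtains M where "maximal_singular \<Pi> M" "S \<subseteq> M"
proof -
  let ?F = "{T. singular_subspace \<Pi> T \<and> S \<subseteq> T}"
  obtain M where "M \<in> ?F" "\<And>T. T \<in> ?F \<Longrightarrow> M \<subseteq> T \<Longrightarrow> T = M"
    using maximal_member[of ?F] assms by blast
  then show ?thesis using that unfolding maximal_singular_def by blast
qed

lemma maximal_singularD: "maximal_singular \<Pi> M \<Longrightarrow> singular_subspace \<Pi> M"
  unfolding maximal_singular_def by simp

text \<open>A point of the perp outside \<open>M\<close> would, by \<open>hyperplane_join\<close>,
  extend \<open>M\<close> to a larger singular subspace.\<close>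

lemma maximal_perp:
  assumes "maximal_singular \<Pi> M"
  shows "perp \<Pi> M = M"
proof
  have sing: "singular_subspace \<Pi> M" using assms maximal_singularD by blast
  then show "M \<subseteq> perp \<Pi> M" by (rule singular_perp)
  show "perp \<Pi> M \<subseteq> M"
  proof (rule ccontr)
    assume "\<not> ?thesis"
    then obtain p where "p \<in> perp \<Pi> M" "p \<notin> M" by blast
    then have "hyperplane \<Pi> M (join (insert p M))" using hyperplane_join sing by blast
    then have "singular_subspace \<Pi> (join (insert p M))" "M \<subset> join (insert p M)"
      using hyperplane_psubset hyperplane_singular by blast+
    then show False using assms unfolding maximal_singular_def by blast
  qed
qed

section \<open>Spans, bases and projective dimension\<close>

lemma span_least: "subspace \<Pi> W \<Longrightarrow> A \<subseteq> W \<Longrightarrow> span \<Pi> A \<subseteq> W"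
  unfolding span_def by blast

lemma span_upper: "A \<subseteq> span \<Pi> A"
  unfolding span_def by blast

lemma span_mono: "A \<subseteq> B \<Longrightarrow> span \<Pi> A \<subseteq> span \<Pi> B"
  unfolding span_def by blast

lemma span_singular:
  assumes "singular_subspace \<Pi> S" "A \<subseteq> S"
  shows "singular_subspace \<Pi> (span \<Pi> A)"
proof -
  have le: "span \<Pi> A \<subseteq> S" using span_least assms singular_subspaceD by blast
  have "subspace \<Pi> (span \<Pi> A)"
  proof (rule subspaceI)
    show "span \<Pi> A \<subseteq> points \<Pi>" using le singular_points[OF assms(1)] by blast
    show "z \<in> span \<Pi> A" if "L \<in> lines \<Pi>" "x \<in> span \<Pi> A" "y \<in> span \<Pi> A" "x \<noteq> y" "x \<in> L" "y \<in> L" "z \<in> L"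
      for L x y z
      using that subspaceD unfolding span_def by (smt (verit, ccfv_threshold) InterE InterI mem_Collect_eq)
  qed
  then show ?thesis using singular_sub assms le by blast
qed

text \<open>The larger span is the double perp of \<open>p\<close> and the span of \<open>A\<close>,
  so \<open>hyperplane_join\<close> shows that a new point raises the rank by exactly one.\<close>

lemma span_insert:
  assumes "singular_subspace \<Pi> S" "A \<subseteq> S" "p \<in> S" "p \<notin> span \<Pi> A"
  shows "hyperplane \<Pi> (span \<Pi> A) (span \<Pi> (insert p A))"
proof -
  have A: "singular_subspace \<Pi> (span \<Pi> A)" using span_singular assms by blast
  have le: "span \<Pi> A \<subseteq> S" using span_least assms singular_subspaceD by blast
  have p: "p \<in> perp \<Pi> (span \<Pi> A)" using singular_perp[OF assms(1)] assms(3) perp_anti[OF le] by blast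
  have "span \<Pi> (insert p A) = join (insert p (span \<Pi> A))"
  proof
    have "insert p (span \<Pi> A) \<subseteq> join (insert p (span \<Pi> A))"
      using join_upper[of "insert p (span \<Pi> A)"] le assms singular_points by blast
    then show "span \<Pi> (insert p A) \<subseteq> join (insert p (span \<Pi> A))"
      using span_upper[of A] by (intro span_least[OF subspace_join]) blast
    have "subspace \<Pi> (span \<Pi> (insert p A))"
      using span_singular[OF assms(1), of "insert p A"] assms singular_subspaceD by blast
    then show "join (insert p (span \<Pi> A)) \<subseteq> span \<Pi> (insert p A)"
      using join_insert_least[OF A p assms(4)] span_mono[of A "insert p A"] span_upper[of "insert p A"]
      by blast
  qed
  then show ?thesis using hyperplane_join[OF A p assms(4)] by simp
qed

lemma span_empty: "span \<Pi> {} = {}"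
  using span_least[OF singular_subspaceD[OF singular_empty]] by blast

lemma rk_span_le:
  assumes "finite B" "singular_subspace \<Pi> S" "B \<subseteq> S"
  shows "rk \<Pi> (span \<Pi> B) \<le> card B"
  using assms(1,3)
proof (induction)
  case (insert p B)
  show ?case
  proof (cases "p \<in> span \<Pi> B")
    case True
    have "subspace \<Pi> (span \<Pi> B)" using span_singular[OF assms(2)] insert singular_subspaceD by blast
    then have "span \<Pi> (insert p B) \<subseteq> span \<Pi> B" using True span_least span_upper by auto
    then have "span \<Pi> (insert p B) = span \<Pi> B" using span_mono[of B "insert p B"] by blast
    then show ?thesis using insert by simp
  next
    case False
    then show ?thesis using rk_hyperplane[OF span_insert[OF assms(2) _ _ False]] insert by simp
  qed
qed (simp add: span_empty rk_empty)

text \<open>By independence \<open>p\<close> lies outside the span of \<open>B\<close>, so it raises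
  the rank by one. \<open>B\<close> inherits independence: a proper subset with the same span would,
  after adding \<open>p\<close>, span as much as \<open>insert p B\<close>.\<close>

lemma rk_independent:
  assumes "finite B" "singular_subspace \<Pi> S" "B \<subseteq> S" "independent \<Pi> B"
  shows "rk \<Pi> (span \<Pi> B) = card B"
  using assms(1,3,4)
proof (induction)
  case (insert p B)
  have sub: "singular_subspace \<Pi> (span \<Pi> A)" if "A \<subseteq> insert p B" for A
    using span_singular[OF assms(2)] subset_trans[OF that insert.prems(1)] by blast
  have p: "p \<notin> span \<Pi> B"
  proof
    assume "p \<in> span \<Pi> B"
    then have "span \<Pi> (insert p B) \<subseteq> span \<Pi> B"
      using span_least[of "span \<Pi> B" "insert p B"] span_upper sub[of B] singular_subspaceD by blast
    then have "span \<Pi> (insert p B) = span \<Pi> B" using span_mono[of B "insert p B"] by blast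
    then show False using insert.hyps(2) insert.prems(2) unfolding independent_def
      by (metis psubsetI subset_insertI insertI1)
  qed
  have "span \<Pi> Y \<noteq> span \<Pi> B" if "Y \<subset> B" for Y
  proof
    assume Y: "span \<Pi> Y = span \<Pi> B"
    have "insert p B \<subseteq> span \<Pi> (insert p Y)"
      using Y span_upper[of B] span_upper[of "insert p Y"] span_mono[of Y "insert p Y"] by blast
    moreover have "subspace \<Pi> (span \<Pi> (insert p Y))"
      using sub[of "insert p Y"] that singular_subspaceD by blast
    ultimately have "span \<Pi> (insert p B) \<subseteq> span \<Pi> (insert p Y)" using span_least by blast
    then have "span \<Pi> (insert p B) = span \<Pi> (insert p Y)"
      using span_mono[of "insert p Y" "insert p B"] that by blast
    moreover have "insert p Y \<subset> insert p B"
      using that insert.hyps(2) unfolding psubset_eq by (metis insert_ident insert_mono subsetD)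
    ultimately show False using insert.prems unfolding independent_def by metis
  qed
  then have "independent \<Pi> B" unfolding independent_def by blast
  then have "rk \<Pi> (span \<Pi> B) = card B" using insert.IH insert.prems(1) by simp
  then show ?case using insert.hyps insert.prems(1) rk_hyperplane[OF span_insert[OF assms(2) _ _ p]] by simp
qed (simp add: span_empty rk_empty)

lemma base_exists: "flag \<Pi> S n \<Longrightarrow> \<exists>B\<subseteq>S. finite B \<and> card B = n \<and> span \<Pi> B = S"
proof (induction rule: flag.induct)
  case flag_empty
  then show ?case using span_empty by auto
next
  case (flag_Suc H n S)
  then obtain B where B: "B \<subseteq> H" "finite B" "card B = n" "span \<Pi> B = H" by blast
  have HS: "H \<subset> S" using flag_Suc hyperplane_psubset by blast
  then obtain p where p: "p \<in> S" "p \<notin> H" by blast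
  have S: "singular_subspace \<Pi> S" using flag_Suc hyperplane_singular by blast
  have "insert p B \<subseteq> S" using B HS p by blast
  moreover have "H \<subseteq> span \<Pi> (insert p B)" using B(4) span_mono[of B "insert p B"] by blast
  then have "S \<subseteq> span \<Pi> (insert p B)"
    using hyperplane_generates[OF flag_Suc.hyps(2) p] span_upper[of "insert p B"]
      span_singular[OF S] calculation singular_subspaceD by blast
  ultimately have "span \<Pi> (insert p B) = S"
    using span_least[OF singular_subspaceD[OF S], of "insert p B"] by blast
  moreover have "p \<notin> B" using B p by blast
  ultimately show ?case using B \<open>insert p B \<subseteq> S\<close> by (intro exI[of _ "insert p B"]) simp
qed

text \<open>Connects bases with flags. Points chosen along a flag form a base, since fewer points
  span a subspace of smaller rank.\<close>

lemma has_dim_iff: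
  assumes "singular_subspace \<Pi> S"
  shows "has_dim \<Pi> S d \<longleftrightarrow> d = int (rk \<Pi> S) - 1"
proof
  assume "has_dim \<Pi> S d"
  then obtain B where B: "finite B" "independent \<Pi> B" "span \<Pi> B = S" "d = int (card B) - 1"
    unfolding has_dim_def by blast
  have "B \<subseteq> S" using B(3) span_upper by blast
  then show "d = int (rk \<Pi> S) - 1" using rk_independent[OF B(1) assms _ B(2)] B by simp
next
  assume d: "d = int (rk \<Pi> S) - 1"
  obtain B where B: "B \<subseteq> S" "finite B" "card B = rk \<Pi> S" "span \<Pi> B = S"
    using base_exists[OF flag_exists[OF assms]] by blast
  have "span \<Pi> Y \<noteq> span \<Pi> B" if "Y \<subset> B" for Y
  proof -
    have "finite Y" "card Y < card B" using that B finite_subset psubset_card_mono by blast+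
    moreover have "rk \<Pi> (span \<Pi> Y) \<le> card Y" using rk_span_le[OF _ assms] that B calculation by blast
    ultimately show ?thesis using B by auto
  qed
  then show "has_dim \<Pi> S d"
    unfolding has_dim_def independent_def using B d assms singular_points by (intro exI[of _ B]) auto
qed

end

locale ranked_polar = polar +
  fixes n :: nat
  assumes rank: "maximal_singular \<Pi> M \<Longrightarrow> rk \<Pi> M = n"
begin

abbreviation "maximal \<equiv> maximal_singular \<Pi>"

lemma in_perpI: "\<lbrakk>q \<in> points \<Pi>; A \<subseteq> perp \<Pi> {q}\<rbrakk> \<Longrightarrow> q \<in> perp \<Pi> A"
  using perp_swap[of "{q}" A] by simp

lemma maximalI:
  assumes "singular_subspace \<Pi> S" "rk \<Pi> S = n"
  shows "maximal S"
proof -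
  obtain M where M: "maximal M" "S \<subseteq> M" using maximal_exists assms(1) by blast
  then have "S = M"
    using rk_eq[OF maximal_singularD[OF M(1)] singular_subspaceD[OF assms(1)]] rank assms(2) by simp
  then show ?thesis using M by simp
qed

lemma maximal_eq: "\<lbrakk>maximal M; maximal N; M \<subseteq> N\<rbrakk> \<Longrightarrow> M = N"
  unfolding maximal_singular_def by metis

lemma singular_maximal_inter: "\<lbrakk>maximal M; maximal N\<rbrakk> \<Longrightarrow> singular_subspace \<Pi> (M \<inter> N)"
  using singular_inter maximal_singularD singular_subspaceD by blast

section \<open>Dual polar graph\<close>

text \<open>Dimension \<open>n - 2\<close> of the intersection means rank \<open>n - 1\<close>;
  \<open>Suc\<close> avoids truncated subtraction.\<close>

definition dadj :: "'a set \<Rightarrow> 'a set \<Rightarrow> bool" where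
  "dadj M N \<longleftrightarrow> maximal M \<and> maximal N \<and> Suc (rk \<Pi> (M \<inter> N)) = n"

lemma dadj_sym: "dadj M N \<Longrightarrow> dadj N M"
  unfolding dadj_def by (simp add: Int_commute)

lemma dadj_maximal: "dadj M N \<Longrightarrow> maximal M \<and> maximal N"
  unfolding dadj_def by simp

lemma dadj_hyperplane:
  assumes "dadj M N"
  shows "hyperplane \<Pi> (M \<inter> N) M"
proof -
  have M: "maximal M" "maximal N" "Suc (rk \<Pi> (M \<inter> N)) = n" using assms unfolding dadj_def by auto
  show ?thesis
    using hyperplane_rkI[OF maximal_singularD[OF M(1)]
        singular_subspaceD[OF singular_maximal_inter[OF M(1,2)]]] rank[OF M(1)] M(3) by simp
qed

lemma dadj_hyperplane': "dadj M N \<Longrightarrow> hyperplane \<Pi> (M \<inter> N) N"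
  using dadj_hyperplane[of N M] dadj_sym by (simp add: Int_commute)

lemma dadjI:
  assumes "maximal M" "maximal N" "M \<noteq> N" "n \<le> Suc (rk \<Pi> (M \<inter> N))"
  shows "dadj M N"
proof -
  have "M \<inter> N \<subset> M" using maximal_eq assms(1-3) by blast
  then have "rk \<Pi> (M \<inter> N) < rk \<Pi> M"
    using rk_less[OF maximal_singularD] singular_subspaceD[OF singular_maximal_inter] assms(1,2) by blast
  then show ?thesis using assms rank unfolding dadj_def by simp
qed

text \<open>The perp of \<open>q\<close> cuts \<open>Y\<close> in a hyperplane, which is also a
  hyperplane of its join with \<open>q\<close>. So this join has rank \<open>n\<close> and is
  maximal.\<close>

lemma neighbour_through:
  assumes "maximal Y" "q \<in> points \<Pi>" "q \<notin> Y"
  obtains B where "dadj B Y" "q \<in> B" "B \<inter> Y = Y \<inter> perp \<Pi> {q}"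
proof -
  let ?H = "Y \<inter> perp \<Pi> {q}" and ?B = "join (insert q (Y \<inter> perp \<Pi> {q}))"
  have Y: "singular_subspace \<Pi> Y" using assms maximal_singularD by blast
  have "\<not> Y \<subseteq> perp \<Pi> {q}"
  proof
    assume "Y \<subseteq> perp \<Pi> {q}"
    then have "q \<in> perp \<Pi> Y" by (rule in_perpI[OF assms(2)])
    then show False using maximal_perp[OF assms(1)] assms(3) by blast
  qed
  then have H: "hyperplane \<Pi> ?H Y" using hyperplane_perp[OF Y assms(2)] by blast
  have "q \<in> perp \<Pi> ?H" using in_perpI[OF assms(2)] by simp
  then have B: "hyperplane \<Pi> ?H ?B"
    using hyperplane_join[of ?H q] hyperplane_singular[OF H] assms(3) by blast
  have qB: "q \<in> ?B"
    using join_upper[of "insert q ?H"] assms(2) singular_points[OF Y] by blast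
  have "rk \<Pi> ?B = n" using rk_hyperplane[OF H] rk_hyperplane[OF B] rank[OF assms(1)] by simp
  then have mB: "maximal ?B" using maximalI hyperplane_singular[OF B] by blast
  have "?B \<inter> Y = ?H"
  proof (rule hyperplane_maximal[OF B])
    show "subspace \<Pi> (?B \<inter> Y)" using singular_subspaceD singular_maximal_inter mB assms(1) by blast
    show "?H \<subseteq> ?B \<inter> Y" using hyperplane_psubset[OF B] by blast
    show "?B \<inter> Y \<subset> ?B" using qB assms(3) by blast
  qed
  moreover have "dadj ?B Y"
    unfolding dadj_def using mB assms(1) calculation rk_hyperplane[OF H] rank[OF assms(1)] by simp
  ultimately show ?thesis using that qB by blast
qed

lemma neighbour_avoiding:
  assumes "maximal Y" "p \<in> Y"
  obtains B where "dadj B Y" "p \<notin> B"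
proof -
  have Y: "singular_subspace \<Pi> Y" using assms maximal_singularD by blast
  have "p \<in> points \<Pi>" using singular_points Y assms(2) by blast
  then obtain q where q: "q \<in> points \<Pi>" "\<not> col p q" using nondegenerate by blast
  then have "q \<notin> Y" using singular_col[OF Y assms(2)] by blast
  then obtain B where B: "dadj B Y" "B \<inter> Y = Y \<inter> perp \<Pi> {q}"
    using neighbour_through[OF assms(1) q(1)] by blast
  have "p \<notin> perp \<Pi> {q}" using q(2) unfolding perp_def by simp
  then show ?thesis using that[OF B(1)] B(2) assms(2) by blast
qed

text \<open>Each point \<open>h\<close> of \<open>X\<close> outside \<open>Y\<close> yields a
  neighbour of \<open>Y\<close> through \<open>h\<close> that meets \<open>X\<close> in more than
  \<open>X \<inter> Y\<close>. If all these neighbours met \<open>Y\<close> in the same hyperplane,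
  it would be perpendicular to \<open>X\<close>, hence inside \<open>X\<close>, and
  \<open>X \<inter> Y\<close> would be too large.\<close>

lemma two_closer_neighbours:
  assumes "maximal X" "maximal Y" "Suc (rk \<Pi> (X \<inter> Y)) < n"
  obtains B1 B2 where "dadj B1 Y" "dadj B2 Y" "B1 \<inter> Y \<noteq> B2 \<inter> Y"
    "rk \<Pi> (X \<inter> Y) < rk \<Pi> (X \<inter> B1)" "rk \<Pi> (X \<inter> Y) < rk \<Pi> (X \<inter> B2)"
proof -
  have X: "singular_subspace \<Pi> X" and Y: "singular_subspace \<Pi> Y"
    using assms maximal_singularD by blast+
  have nb: "\<exists>B. dadj B Y \<and> B \<inter> Y = Y \<inter> perp \<Pi> {h} \<and> rk \<Pi> (X \<inter> Y) < rk \<Pi> (X \<inter> B)"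
    if h: "h \<in> X" "h \<notin> Y" for h
  proof -
    have "h \<in> points \<Pi>" using h singular_points[OF X] by blast
    then obtain B where B: "dadj B Y" "h \<in> B" "B \<inter> Y = Y \<inter> perp \<Pi> {h}"
      using neighbour_through[OF assms(2) _ h(2)] by blast
    have "X \<subseteq> perp \<Pi> {h}" using singular_perp[OF X] perp_anti[of "{h}" X] h by blast
    then have "X \<inter> Y \<subset> X \<inter> B" using B h by blast
    then have "rk \<Pi> (X \<inter> Y) < rk \<Pi> (X \<inter> B)"
      using rk_less singular_maximal_inter singular_subspaceD assms(1,2) B(1) dadj_maximal by metis
    then show ?thesis using B by blast
  qed
  have "\<exists>h1 h2. h1 \<in> X \<and> h1 \<notin> Y \<and> h2 \<in> X \<and> h2 \<notin> Y \<and> Y \<inter> perp \<Pi> {h1} \<noteq> Y \<inter> perp \<Pi> {h2}"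
  proof (rule ccontr)
    assume neg: "\<not> ?thesis"
    have "\<not> X \<subseteq> Y"
      using maximal_eq[OF assms(1,2)] assms(3) rank[OF assms(2)] by fastforce
    then obtain h where h: "h \<in> X" "h \<notin> Y" by blast
    let ?H = "Y \<inter> perp \<Pi> {h}"
    obtain B where B: "dadj B Y" "B \<inter> Y = ?H" using nb[OF h] by blast
    have "col y x" if y: "y \<in> ?H" and x: "x \<in> X" for x y
    proof (cases "x \<in> Y")
      case True
      then show ?thesis using singular_col[OF Y] y by blast
    next
      case False
      then have "y \<in> perp \<Pi> {x}" using neg h x y by blast
      then show ?thesis unfolding perp_def by simp
    qed
    then have "?H \<subseteq> perp \<Pi> X" using singular_points[OF Y] unfolding perp_def by blast
    then have "B \<inter> Y \<subseteq> X \<inter> Y" using maximal_perp[OF assms(1)] B(2) by blast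
    then have "rk \<Pi> (B \<inter> Y) \<le> rk \<Pi> (X \<inter> Y)"
      using rk_mono singular_maximal_inter singular_subspaceD assms(1,2) B(1) dadj_maximal by metis
    then show False using B(1) assms(3) unfolding dadj_def by simp
  qed
  then obtain h1 h2 where h: "h1 \<in> X" "h1 \<notin> Y" "h2 \<in> X" "h2 \<notin> Y"
    "Y \<inter> perp \<Pi> {h1} \<noteq> Y \<inter> perp \<Pi> {h2}" by blast
  show ?thesis using nb[OF h(1,2)] nb[OF h(3,4)] h(5) that by metis
qed

text \<open>A point of \<open>M \<inter> N\<close> is perpendicular to two distinct hyperplanes of
  \<open>C\<close>, which generate \<open>C\<close>; so it lies in the perp of \<open>C\<close>,
  which is \<open>C\<close>. Thus \<open>M \<inter> N\<close> is the intersection of two hyperplanes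
  of \<open>C\<close>.\<close>

lemma common_neighbour_inter:
  assumes "dadj M C" "dadj N C" "M \<inter> C \<noteq> N \<inter> C"
  shows "M \<inter> N \<subseteq> C" "Suc (Suc (rk \<Pi> (M \<inter> N))) = n"
proof -
  have max: "maximal M" "maximal N" "maximal C" using assms dadj_maximal by blast+
  have rks: "rk \<Pi> (M \<inter> C) = rk \<Pi> (N \<inter> C)" using assms unfolding dadj_def by simp
  have "\<not> N \<inter> C \<subseteq> M \<inter> C"
    using rk_eq[OF singular_maximal_inter[OF max(1,3)] singular_subspaceD[OF singular_maximal_inter[OF max(2,3)]]]
      rks assms(3) by metis
  then obtain b where b: "b \<in> N" "b \<in> C" "b \<notin> M \<inter> C" by blast
  show sub: "M \<inter> N \<subseteq> C"
  proof
    fix x assume x: "x \<in> M \<inter> N"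
    have sing: "singular_subspace \<Pi> M" "singular_subspace \<Pi> N" using max maximal_singularD by blast+
    have "M \<inter> C \<subseteq> perp \<Pi> {x}" "b \<in> perp \<Pi> {x}"
      using singular_perp[OF sing(1)] singular_perp[OF sing(2)] perp_anti[of "{x}"] x b by blast+
    then have "C \<subseteq> perp \<Pi> {x}"
      using hyperplane_generates[OF dadj_hyperplane'[OF assms(1)] b(2,3) subspace_perp] by blast
    moreover have "x \<in> points \<Pi>" using x singular_points[OF sing(1)] by blast
    ultimately have "x \<in> perp \<Pi> C" using in_perpI by simp
    then show "x \<in> C" using maximal_perp[OF max(3)] by blast
  qed
  have eq: "(N \<inter> C) \<inter> (M \<inter> C) = M \<inter> N" using sub by blast
  have "hyperplane \<Pi> ((N \<inter> C) \<inter> (M \<inter> C)) (N \<inter> C)"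
    using hyperplane_inter[OF dadj_hyperplane'[OF assms(1)], of "N \<inter> C"]
      singular_subspaceD[OF singular_maximal_inter[OF max(2,3)]] \<open>\<not> N \<inter> C \<subseteq> M \<inter> C\<close> by blast
  then show "Suc (Suc (rk \<Pi> (M \<inter> N))) = n"
    using rk_hyperplane assms(2) unfolding eq dadj_def by metis
qed

lemma common_neighbour_neq:
  assumes "dadj M C" "dadj N C" "Suc (Suc (rk \<Pi> (M \<inter> N))) = n"
  shows "M \<inter> C \<noteq> N \<inter> C"
proof
  assume "M \<inter> C = N \<inter> C"
  then have "M \<inter> C \<subseteq> M \<inter> N" by blast
  then have "rk \<Pi> (M \<inter> C) \<le> rk \<Pi> (M \<inter> N)"
    using rk_mono singular_maximal_inter singular_subspaceD assms dadj_maximal by metis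
  then show False using assms unfolding dadj_def by simp
qed

text \<open>Equal traces on \<open>C\<close> lie in \<open>M \<inter> N\<close>, distinct ones give
  rank \<open>n - 2\<close>. An intersection of smaller rank therefore excludes a common
  neighbour.\<close>

lemma two_step_rk:
  assumes "dadj M C" "dadj C N"
  shows "n \<le> Suc (Suc (rk \<Pi> (M \<inter> N)))"
proof (cases "M \<inter> C = N \<inter> C")
  case True
  then have "M \<inter> C \<subseteq> M \<inter> N" by blast
  then have "rk \<Pi> (M \<inter> C) \<le> rk \<Pi> (M \<inter> N)"
    using rk_mono singular_maximal_inter singular_subspaceD assms dadj_maximal by metis
  then show ?thesis using assms unfolding dadj_def by simp
next
  case False
  then show ?thesis using common_neighbour_inter(2)[OF assms(1) dadj_sym[OF assms(2)]] by simp
qed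

text \<open>\<open>W\<close> is the gate of \<open>K\<close> in the quad of all maximal singular subspaces through \<open>W \<inter> V\<close>.\<close>

lemma gate:
  assumes "dadj K W" "maximal V" "\<not> W \<inter> V \<subseteq> K"
  shows "rk \<Pi> (K \<inter> V) < rk \<Pi> (W \<inter> V)"
proof -
  have max: "maximal K" "maximal W" using assms dadj_maximal by blast+
  have sing: "singular_subspace \<Pi> K" "singular_subspace \<Pi> V" using max assms(2) maximal_singularD by blast+
  obtain p where p: "p \<in> W" "p \<in> V" "p \<notin> K" using assms(3) by blast
  have "K \<inter> V \<subseteq> W"
  proof
    fix x assume x: "x \<in> K \<inter> V"
    have "K \<inter> W \<subseteq> perp \<Pi> {x}" "p \<in> perp \<Pi> {x}"
      using singular_perp[OF sing(1)] singular_perp[OF sing(2)] perp_anti[of "{x}"] x p by blast+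
    then have "W \<subseteq> perp \<Pi> {x}"
      using hyperplane_generates[OF dadj_hyperplane'[OF assms(1)] p(1) _ subspace_perp] p(3) by blast
    moreover have "x \<in> points \<Pi>" using x singular_points[OF sing(1)] by blast
    ultimately have "x \<in> perp \<Pi> W" using in_perpI by simp
    then show "x \<in> W" using maximal_perp[OF max(2)] by blast
  qed
  then have "K \<inter> V \<subset> W \<inter> V" using p by blast
  then show ?thesis
    using rk_less singular_maximal_inter singular_subspaceD max assms(2) by metis
qed

lemma two_common_neighbours:
  assumes "maximal M" "maximal N" "Suc (Suc (rk \<Pi> (M \<inter> N))) = n"
  obtains W1 W2 where "dadj W1 M" "dadj W2 M" "dadj W1 N" "dadj W2 N" "W1 \<inter> M \<noteq> W2 \<inter> M"
proof -
  have eq: "N \<inter> M = M \<inter> N" by blast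
  obtain W1 W2 where W: "dadj W1 M" "dadj W2 M" "W1 \<inter> M \<noteq> W2 \<inter> M"
    "rk \<Pi> (M \<inter> N) < rk \<Pi> (N \<inter> W1)" "rk \<Pi> (M \<inter> N) < rk \<Pi> (N \<inter> W2)"
    using two_closer_neighbours[OF assms(2,1)] assms(3) unfolding eq by auto
  have "dadj W N" if "dadj W M" "rk \<Pi> (M \<inter> N) < rk \<Pi> (N \<inter> W)" for W
  proof (rule dadj_sym, rule dadjI)
    show "N \<noteq> W" using that(1) assms(3) eq unfolding dadj_def by auto
    show "n \<le> Suc (rk \<Pi> (N \<inter> W))" using that(2) assms(3) by linarith
  qed (use that assms dadj_maximal in auto)
  then show ?thesis using that W by blast
qed

text \<open>Two quadrangles, \<open>M\<close>, \<open>W1\<close>, \<open>N\<close>,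
  \<open>W2\<close> and \<open>M\<close>, \<open>X\<close>, \<open>K\<close>, \<open>W1\<close>,
  share the edge from \<open>M\<close> to \<open>W1\<close>. Neither \<open>X\<close> nor
  \<open>K\<close> contains \<open>M \<inter> N\<close>, so by \<open>gate\<close> the pairs
  \<open>X\<close>, \<open>N\<close> and \<open>K\<close>, \<open>W2\<close> are too far apart for
  distance 2.\<close>

lemma hexagon_configuration:
  assumes "maximal M" "maximal N" "Suc (Suc (rk \<Pi> (M \<inter> N))) = n" "n \<ge> 3"
  obtains W1 W2 X K where
    "dadj W1 M" "dadj W2 M" "dadj W1 N" "dadj W2 N" "W1 \<noteq> W2" "dadj X M" "dadj K X" "dadj K W1"
    "Suc (Suc (rk \<Pi> (K \<inter> M))) = n" "Suc (Suc (rk \<Pi> (K \<inter> N))) = n"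
    "Suc (Suc (rk \<Pi> (X \<inter> N))) < n" "Suc (Suc (rk \<Pi> (K \<inter> W2))) < n"
proof -
  obtain W1 W2 where W: "dadj W1 M" "dadj W2 M" "dadj W1 N" "dadj W2 N" "W1 \<inter> M \<noteq> W2 \<inter> M"
    using two_common_neighbours[OF assms(1-3)] by blast
  have inW: "M \<inter> N \<subseteq> W" if "dadj W M" "dadj W N" for W
    using common_neighbour_inter(1) common_neighbour_neq dadj_sym that assms(3) by metis
  have WW: "Suc (Suc (rk \<Pi> (W1 \<inter> W2))) = n" using common_neighbour_inter(2)[OF W(1,2,5)] .
  have mW: "maximal W1" "maximal W2" using W dadj_maximal by blast+
  \<comment> \<open>With this equality \<open>gate\<close> applies to \<open>W2\<close> as well as
    to \<open>N\<close>.\<close>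
  have W12: "M \<inter> N = W1 \<inter> W2"
    using rk_eq[OF singular_maximal_inter[OF mW] singular_subspaceD[OF singular_maximal_inter[OF assms(1,2)]]]
      inW W WW assms(3) by auto
  have "M \<inter> N \<noteq> {}" using assms(3,4) rk_empty by force
  then obtain p where p: "p \<in> M" "p \<in> N" by blast
  obtain X where X: "dadj X M" "p \<notin> X" using neighbour_avoiding[OF assms(1) p(1)] by blast
  have mX: "maximal X" using X dadj_maximal by blast
  have XN: "Suc (Suc (rk \<Pi> (X \<inter> N))) < n" using gate[OF X(1) assms(2)] X(2) p assms(3) by force
  have pW: "p \<in> W1" using inW W p by blast
  have "X \<inter> M \<noteq> W1 \<inter> M" using p X pW by blast
  then have XW: "X \<inter> W1 \<subseteq> M" "Suc (Suc (rk \<Pi> (X \<inter> W1))) = n"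
    using common_neighbour_inter[OF X(1) W(1)] by blast+
  \<comment> \<open>\<open>X\<close> and \<open>W1\<close> have two common neighbours with distinct
    traces on \<open>W1\<close>; at least one trace differs from that of \<open>M\<close>.\<close>
  obtain K where K: "dadj K X" "dadj K W1" "K \<inter> W1 \<noteq> M \<inter> W1"
  proof -
    have "W1 \<inter> X = X \<inter> W1" by blast
    then obtain K1 K2 where "dadj K1 W1" "dadj K2 W1" "dadj K1 X" "dadj K2 X" "K1 \<inter> W1 \<noteq> K2 \<inter> W1"
      using two_common_neighbours[OF mW(1) mX] XW(2) by metis
    then show ?thesis using that by metis
  qed
  have mK: "maximal K" using K dadj_maximal by blast
  have KM: "Suc (Suc (rk \<Pi> (K \<inter> M))) = n"
    using common_neighbour_inter(2)[OF K(2) dadj_sym[OF W(1)] K(3)] .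
  \<comment> \<open>Otherwise \<open>M \<inter> N\<close> and \<open>X \<inter> W1\<close> would
    both equal \<open>K \<inter> M\<close> by rank, which would put \<open>p\<close> into
    \<open>X\<close>.\<close>
  have nK: "\<not> M \<inter> N \<subseteq> K"
  proof
    assume "M \<inter> N \<subseteq> K"
    then have "M \<inter> N \<subseteq> K \<inter> M" by blast
    then have "M \<inter> N = K \<inter> M"
      using rk_eq[OF singular_maximal_inter[OF mK assms(1)] singular_subspaceD[OF singular_maximal_inter[OF assms(1,2)]]]
        KM assms(3) by simp
    moreover have "X \<inter> W1 \<subseteq> K"
      using common_neighbour_inter(1) common_neighbour_neq dadj_sym K XW(2) by metis
    then have "X \<inter> W1 \<subseteq> K \<inter> M" using XW by blast
    then have "X \<inter> W1 = K \<inter> M"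
      using rk_eq[OF singular_maximal_inter[OF mK assms(1)] singular_subspaceD[OF singular_maximal_inter[OF mX mW(1)]]]
        KM XW(2) by simp
    ultimately show False using p X by blast
  qed
  have "K \<inter> W1 \<noteq> N \<inter> W1" using nK inW[OF W(1,3)] by blast
  then have KN: "Suc (Suc (rk \<Pi> (K \<inter> N))) = n"
    using common_neighbour_inter(2)[OF K(2) dadj_sym[OF W(3)]] by blast
  have "Suc (Suc (rk \<Pi> (K \<inter> W2))) < n" using gate[OF K(2) mW(2)] nK W12 WW by simp
  then show ?thesis using that[OF W(1-4) _ X(1) K(1,2) KM KN XN] W(5) by blast
qed

lemma distance_three_exists:
  assumes "n \<ge> 3"
  obtains X A B N where "dadj X A" "dadj A B" "dadj B N" "Suc (Suc (rk \<Pi> (X \<inter> N))) < n"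
proof -
  obtain M where M: "maximal M" using maximal_exists[OF singular_empty] by blast
  have "M \<noteq> {}" using rank[OF M] assms rk_empty by force
  then obtain W where W: "dadj W M" using neighbour_avoiding[OF M] by blast
  have "W \<inter> M \<noteq> {}" using W assms rk_empty unfolding dadj_def by force
  then obtain p where p: "p \<in> W" "p \<in> M" by blast
  obtain N where N: "dadj N W" "p \<notin> N" using neighbour_avoiding[of W] p W dadj_maximal by blast
  have "M \<inter> W \<noteq> N \<inter> W" using p N by blast
  then have "Suc (Suc (rk \<Pi> (M \<inter> N))) = n"
    using common_neighbour_inter(2)[OF dadj_sym[OF W] N(1)] by blast
  moreover have "maximal N" using N dadj_maximal by blast
  ultimately obtain W1 X where "dadj W1 M" "dadj W1 N" "dadj X M" "Suc (Suc (rk \<Pi> (X \<inter> N))) < n"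
    using hexagon_configuration[OF M _ _ assms] by metis
  then show ?thesis using that dadj_sym by blast
qed

section \<open>Polar Grassmann graph\<close>

text \<open>Vertices of the polar Grassmann graph, with \<open>r\<close> standing for
  \<open>k + 1\<close>.\<close>

definition vert :: "nat \<Rightarrow> 'a set \<Rightarrow> bool" where
  "vert r S \<longleftrightarrow> singular_subspace \<Pi> S \<and> rk \<Pi> S = r"

definition gadj :: "nat \<Rightarrow> 'a set \<Rightarrow> 'a set \<Rightarrow> bool" where
  "gadj r S T \<longleftrightarrow> vert r S \<and> vert r T \<and> S \<noteq> T \<and> (\<exists>W. vert (Suc r) W \<and> S \<subseteq> W \<and> T \<subseteq> W)"

text \<open>Graph distance at most 2: the middle vertex \<open>C\<close> may coincide with an
  end.\<close>

definition near :: "nat \<Rightarrow> 'a set \<Rightarrow> 'a set \<Rightarrow> bool" where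
  "near r S T \<longleftrightarrow> (\<exists>C. (S = C \<or> gadj r S C) \<and> (C = T \<or> gadj r C T))"

lemma gadj_sym: "gadj r S T \<Longrightarrow> gadj r T S"
  unfolding gadj_def by blast

lemma gadj_vert: "gadj r S T \<Longrightarrow> vert r S \<and> vert r T"
  unfolding gadj_def by blast

lemma vert_singular: "vert r S \<Longrightarrow> singular_subspace \<Pi> S"
  unfolding vert_def by blast

lemma vert_subspace: "vert r S \<Longrightarrow> subspace \<Pi> S"
  using vert_singular singular_subspaceD by blast

lemma vert_points: "vert r S \<Longrightarrow> S \<subseteq> points \<Pi>"
  using vert_singular singular_points by blast

lemma vert_eq: "\<lbrakk>vert r S; vert r T; S \<subseteq> T\<rbrakk> \<Longrightarrow> S = T"
  using rk_eq singular_subspaceD unfolding vert_def by metis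

lemma gadj_perp:
  assumes "gadj r S T"
  shows "T \<subseteq> perp \<Pi> S"
proof -
  obtain W where W: "singular_subspace \<Pi> W" "S \<subseteq> W" "T \<subseteq> W"
    using assms unfolding gadj_def vert_def by blast
  show ?thesis using singular_perp[OF W(1)] perp_anti[OF W(2)] W(3) by blast
qed

lemma gadj_hyperplane:
  assumes "gadj r S T"
  shows "hyperplane \<Pi> (S \<inter> T) S"
proof -
  have v: "vert r S" "vert r T" "S \<noteq> T" using assms unfolding gadj_def by blast+
  obtain W where W: "singular_subspace \<Pi> W" "S \<subseteq> W" "T \<subseteq> W" "rk \<Pi> W = Suc r"
    using assms unfolding gadj_def vert_def by blast
  have "hyperplane \<Pi> T W"
    using hyperplane_rkI[OF W(1) vert_subspace[OF v(2)] W(3)] W(4) v(2) unfolding vert_def by simp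
  moreover have "\<not> S \<subseteq> T" using vert_eq v by blast
  ultimately show ?thesis using hyperplane_inter vert_subspace v(1) W(2) by blast
qed

lemma gadj_hyperplane': "gadj r S T \<Longrightarrow> hyperplane \<Pi> (S \<inter> T) T"
  using gadj_hyperplane[of r T S] gadj_sym by (simp add: Int_commute)

text \<open>\<open>S\<close> and a point of \<open>T\<close> outside \<open>S\<close> generate a
  subspace of rank \<open>r + 1\<close>; it contains \<open>H\<close> and a further point of
  \<open>T\<close>, hence \<open>T\<close>.\<close>

lemma adjacent_or_eq:
  assumes "vert r S" "vert r T" "T \<subseteq> perp \<Pi> S" "hyperplane \<Pi> H S" "hyperplane \<Pi> H T"
  shows "S = T \<or> gadj r S T"
proof (cases "T \<subseteq> S")
  case True
  then show ?thesis using vert_eq assms by blast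
next
  case False
  then obtain t where t: "t \<in> T" "t \<notin> S" by blast
  have tp: "t \<in> perp \<Pi> S" using t assms by blast
  have h: "hyperplane \<Pi> S (join (insert t S))"
    using hyperplane_join[OF vert_singular[OF assms(1)] tp t(2)] .
  have up: "insert t S \<subseteq> join (insert t S)"
    using join_upper[of "insert t S"] t(1) vert_points assms(1,2) by blast
  have "T \<subseteq> join (insert t S)"
    using hyperplane_generates[OF assms(5) t(1) _ subspace_join] up t(2)
      hyperplane_psubset[OF assms(4)] by blast
  moreover have "vert (Suc r) (join (insert t S))"
    using hyperplane_singular[OF h] rk_hyperplane[OF h] assms(1) unfolding vert_def by simp
  ultimately show ?thesis using assms(1,2) up unfolding gadj_def by blast
qed

lemma adjacent_or_eq_in:
  assumes "vert r S" "vert r T" "vert (Suc r) W" "S \<subseteq> W" "T \<subseteq> W"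
  shows "S = T \<or> gadj r S T"
  using assms unfolding gadj_def by blast

lemma vert_joinI:
  assumes "hyperplane \<Pi> Z S" "vert r S" "w \<in> perp \<Pi> Z" "w \<notin> Z"
  shows "vert r (join (insert w Z))" "hyperplane \<Pi> Z (join (insert w Z))"
proof -
  show h: "hyperplane \<Pi> Z (join (insert w Z))"
    using hyperplane_join hyperplane_singular[OF assms(1)] assms(3,4) by blast
  show "vert r (join (insert w Z))"
    using hyperplane_singular[OF h] rk_hyperplane[OF h] rk_hyperplane[OF assms(1)] assms(2)
    unfolding vert_def by simp
qed

text \<open>The residue of \<open>Z\<close> is a polar space of rank at least 2, so its collinearity graph has diameter 2.\<close>

lemma near_in_star:
  assumes "vert r S" "vert r T" "hyperplane \<Pi> Z S" "hyperplane \<Pi> Z T" "r < n"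
  shows "near r S T"
proof (cases "T \<subseteq> perp \<Pi> S")
  case True
  then have "S = T \<or> gadj r S T" by (rule adjacent_or_eq[OF assms(1,2) _ assms(3,4)])
  then show ?thesis unfolding near_def by blast
next
  case False
  have Z: "singular_subspace \<Pi> Z" "Z \<subset> S" "Z \<subset> T" "subspace \<Pi> Z"
    using hyperplane_singular[OF assms(3)] hyperplane_psubset[OF assms(3)]
      hyperplane_psubset[OF assms(4)] singular_subspaceD by simp_all
  obtain U where U: "maximal U" "S \<subseteq> U" using maximal_exists vert_singular assms(1) by blast
  have sU: "singular_subspace \<Pi> U" using U maximal_singularD by blast
  obtain t where t: "t \<in> T" "t \<notin> Z" using Z by blast
  have tp: "t \<in> points \<Pi>" using t vert_points assms by blast
  have Zt: "Z \<subseteq> perp \<Pi> {t}"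
    using Z singular_perp[OF vert_singular[OF assms(2)]] perp_anti[of "{t}" T] t by blast
  have "\<not> U \<subseteq> perp \<Pi> {t}"
  proof
    assume "U \<subseteq> perp \<Pi> {t}"
    then have "t \<in> perp \<Pi> U" by (rule in_perpI[OF tp])
    then have "t \<in> U" using maximal_perp[OF U(1)] by blast
    then have "T \<subseteq> U"
      using hyperplane_generates[OF assms(4) t singular_subspaceD[OF sU]] Z U by blast
    then show False using False singular_perp[OF sU] perp_anti[OF U(2)] by blast
  qed
  then have h: "hyperplane \<Pi> (U \<inter> perp \<Pi> {t}) U" using hyperplane_perp[OF sU tp] by blast
  \<comment> \<open>A hyperplane of \<open>U\<close> has rank \<open>n - 1\<close>, while
    \<open>Z\<close> has rank \<open>r - 1\<close>, which is smaller.\<close>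
  have "\<not> U \<inter> perp \<Pi> {t} \<subseteq> Z"
  proof
    assume "U \<inter> perp \<Pi> {t} \<subseteq> Z"
    then have "rk \<Pi> (U \<inter> perp \<Pi> {t}) \<le> rk \<Pi> Z"
      using rk_mono[OF Z(1)] hyperplane_singular[OF h] singular_subspaceD by blast
    then show False
      using rk_hyperplane[OF h] rk_hyperplane[OF assms(3)] rank[OF U(1)] assms(1,5)
      unfolding vert_def by simp
  qed
  then obtain w where w: "w \<in> U" "w \<in> perp \<Pi> {t}" "w \<notin> Z" by blast
  have ZU: "Z \<subseteq> U" using Z U by blast
  have wZ: "w \<in> perp \<Pi> Z" using singular_perp[OF sU] w(1) perp_anti[OF ZU] by blast
  let ?C = "join (insert w Z)"
  have C: "vert r ?C" "hyperplane \<Pi> Z ?C" using vert_joinI[OF assms(3,1) wZ w(3)] .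
  have "?C \<subseteq> U" using join_insert_least[OF Z(1) wZ w(3) singular_subspaceD[OF sU] ZU w(1)] .
  then have "?C \<subseteq> perp \<Pi> S" using singular_perp[OF sU] perp_anti[OF U(2)] by blast
  then have SC: "S = ?C \<or> gadj r S ?C" using adjacent_or_eq[OF assms(1) C(1) _ assms(3) C(2)] by blast
  have "Z \<subseteq> perp \<Pi> {w}" using wZ singular_points[OF Z(1)] col_sym unfolding perp_def by blast
  moreover have "t \<in> perp \<Pi> {w}" using w(2) tp col_sym unfolding perp_def by blast
  ultimately have "T \<subseteq> perp \<Pi> {w}"
    using hyperplane_generates[OF assms(4) t subspace_perp] by blast
  then have "w \<in> perp \<Pi> T" using in_perpI[of w T] w(1) singular_points[OF sU] by blast
  moreover have "Z \<subseteq> perp \<Pi> T"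
    using Z singular_perp[OF vert_singular[OF assms(2)]] by blast
  ultimately have "?C \<subseteq> perp \<Pi> T" using join_insert_least[OF Z(1) wZ w(3) subspace_perp] by blast
  then have "?C = T \<or> gadj r ?C T"
    using adjacent_or_eq[OF assms(2) C(1) _ assms(4) C(2)] gadj_sym by blast
  then show ?thesis using SC unfolding near_def by blast
qed

text \<open>The middle vertex is the join \<open>?V\<close> of \<open>v\<close> and
  \<open>Z\<close>. It is perpendicular to \<open>Y\<close> and shares the hyperplane
  \<open>Z\<close> with it. Moreover it lies in the join of \<open>X\<close> with a point of
  \<open>Z\<close> outside \<open>X\<close>, because that join contains all of
  \<open>Z\<close>.\<close>

lemma near_of_common_part:
  assumes "gadj r X M" "hyperplane \<Pi> Z M" "\<not> Z \<subseteq> X"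
    and "vert r Y" "hyperplane \<Pi> Z Y" "v \<in> X" "v \<notin> M" "v \<in> perp \<Pi> Y"
  shows "near r X Y"
proof -
  have Z: "singular_subspace \<Pi> Z" "Z \<subset> M" "Z \<subset> Y"
    using hyperplane_singular[OF assms(2)] hyperplane_psubset[OF assms(2)]
      hyperplane_psubset[OF assms(5)] by simp_all
  have vX: "vert r X" "vert r M" using assms(1) gadj_vert by blast+
  have XM: "X \<subseteq> perp \<Pi> M" "M \<subseteq> perp \<Pi> X" using gadj_perp assms(1) gadj_sym by blast+
  have vZ: "v \<in> perp \<Pi> Z" "v \<notin> Z" using assms(6,7) XM(1) perp_anti[of Z M] Z(2) by blast+
  let ?V = "join (insert v Z)"
  have V: "vert r ?V" "hyperplane \<Pi> Z ?V" using vert_joinI[OF assms(2) vX(2) vZ] .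
  have "Z \<subseteq> perp \<Pi> Y" using singular_perp[OF vert_singular[OF assms(4)]] Z(3) by blast
  then have "?V \<subseteq> perp \<Pi> Y" using join_insert_least[OF Z(1) vZ subspace_perp] assms(8) by blast
  then have VY: "?V = Y \<or> gadj r ?V Y"
    using adjacent_or_eq[OF assms(4) V(1) _ assms(5) V(2)] gadj_sym by blast
  obtain z where z: "z \<in> Z" "z \<notin> X" using assms(3) by blast
  have zX: "z \<in> perp \<Pi> X" using z XM Z by blast
  let ?W = "join (insert z X)"
  have W: "hyperplane \<Pi> X ?W" using hyperplane_join[OF vert_singular[OF vX(1)] zX z(2)] .
  have up: "insert z X \<subseteq> ?W"
    using join_upper[of "insert z X"] z(1) singular_points[OF Z(1)] vert_points[OF vX(1)] by blast
  have "\<not> Z \<subseteq> X \<inter> M" using assms(3) by blast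
  then have "hyperplane \<Pi> (Z \<inter> (X \<inter> M)) Z"
    using hyperplane_inter[OF gadj_hyperplane'[OF assms(1)] singular_subspaceD[OF Z(1)]] Z(2) by blast
  then have "Z \<subseteq> ?W" using hyperplane_generates[OF _ z(1) _ subspace_join] z(2) up by blast
  then have "?V \<subseteq> ?W" using join_insert_least[OF Z(1) vZ subspace_join] up assms(6) by blast
  moreover have "vert (Suc r) ?W"
    using hyperplane_singular[OF W] rk_hyperplane[OF W] vX(1) unfolding vert_def by simp
  ultimately have "X = ?V \<or> gadj r X ?V" using adjacent_or_eq_in[OF vX(1) V(1)] up by blast
  then show ?thesis using VY unfolding near_def by blast
qed

text \<open>\<open>S \<inter> C\<close> is a hyperplane of \<open>S\<close> inside the proper
  subspace \<open>S \<inter> perp \<Pi> T\<close>, so they agree. The trace thus does not depend on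
  \<open>C\<close>.\<close>

lemma common_neighbour_trace:
  assumes "gadj r S C" "gadj r T C" "\<not> T \<subseteq> perp \<Pi> S"
  shows "S \<inter> C = S \<inter> perp \<Pi> T"
proof -
  have v: "vert r S" "vert r T" using assms gadj_vert by blast+
  have "C \<subseteq> perp \<Pi> T" using gadj_perp assms(2) by blast
  then have "S \<inter> C \<subseteq> S \<inter> perp \<Pi> T" by blast
  moreover have "S \<inter> perp \<Pi> T \<subset> S" using assms(3) perp_swap[OF vert_points[OF v(2)]] by blast
  ultimately show ?thesis
    using hyperplane_maximal[OF gadj_hyperplane[OF assms(1)]
        subspace_inter[OF vert_subspace[OF v(1)] subspace_perp]] by metis
qed

text \<open>The traces \<open>?A\<close> on \<open>S\<close> and \<open>?B\<close> on
  \<open>T\<close> are the same for all common neighbours. If they were different, \<open>?A\<close>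
  and a point of \<open>?B\<close> would generate \<open>C\<close> inside \<open>C'\<close>, forcing
  \<open>C = C'\<close>.\<close>

lemma common_neighbours_trace:
  assumes "gadj r S C" "gadj r T C" "gadj r S C'" "gadj r T C'" "C \<noteq> C'" "\<not> T \<subseteq> perp \<Pi> S"
    and "gadj r S D" "gadj r T D"
  shows "S \<inter> D = T \<inter> D"
proof -
  have v: "vert r S" "vert r T" "vert r C" "vert r C'" using assms gadj_vert by blast+
  have ns: "\<not> S \<subseteq> perp \<Pi> T" using assms(6) perp_swap[OF vert_points[OF v(1)]] perp_swap[OF vert_points[OF v(2)]] by blast
  let ?A = "S \<inter> perp \<Pi> T" and ?B = "T \<inter> perp \<Pi> S"
  have tr: "S \<inter> E = ?A" "T \<inter> E = ?B" if "gadj r S E" "gadj r T E" for E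
    using common_neighbour_trace that assms(6) ns by blast+
  have hA: "hyperplane \<Pi> ?A C" and hB: "hyperplane \<Pi> ?B C"
    using gadj_hyperplane'[OF assms(1)] gadj_hyperplane'[OF assms(2)] tr[OF assms(1,2)] by auto
  have "?B \<subseteq> ?A"
  proof (rule ccontr)
    assume "\<not> ?thesis"
    then obtain b where b: "b \<in> ?B" "b \<notin> ?A" by blast
    have "b \<in> C" "b \<in> C'" "?A \<subseteq> C'" using b tr[OF assms(1,2)] tr[OF assms(3,4)] by blast+
    then have "C \<subseteq> C'" using hyperplane_generates[OF hA _ b(2) vert_subspace[OF v(4)]] by blast
    then show False using vert_eq v assms(5) by blast
  qed
  then have "?B = ?A"
    using rk_eq[of ?A ?B] rk_hyperplane[OF hA] rk_hyperplane[OF hB] hyperplane_singular[OF hA]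
      hyperplane_singular[OF hB] singular_subspaceD by auto
  then show ?thesis using tr[OF assms(7,8)] by simp
qed

text \<open>Perpendicular \<open>S\<close> and \<open>T\<close> lie in one maximal \<open>U\<close>.
  If \<open>n = r + 1\<close> they are adjacent or equal. If \<open>n = r + 2\<close>, let
  \<open>?W\<close> be the join of \<open>S\<close> with a point of \<open>T\<close>; the join of
  \<open>T \<inter> ?W\<close> with a point of \<open>S\<close> is then a middle vertex.\<close>

lemma far_rank:
  assumes "vert r S" "vert r T" "T \<subseteq> perp \<Pi> S" "\<not> near r S T" "r < n"
  shows "r + 3 \<le> n"
proof (rule ccontr)
  assume "\<not> ?thesis"
  then have n: "n = Suc r \<or> n = Suc (Suc r)" using assms(5) by linarith
  have ng: "S \<noteq> T" "\<not> gadj r S T" using assms(4) unfolding near_def by blast+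
  have pts: "S \<union> T \<subseteq> points \<Pi>" using vert_points assms(1,2) by blast
  have "S \<union> T \<subseteq> perp \<Pi> (S \<union> T)"
    using singular_perp[OF vert_singular[OF assms(1)]] singular_perp[OF vert_singular[OF assms(2)]]
      assms(3) perp_swap[OF vert_points[OF assms(1)] assms(3)] unfolding perp_def by blast
  then obtain U where U: "maximal U" "join (S \<union> T) \<subseteq> U" using join_singular maximal_exists by blast
  then have STU: "S \<subseteq> U" "T \<subseteq> U" using join_upper[OF pts] by blast+
  have sU: "singular_subspace \<Pi> U" using U maximal_singularD by blast
  have rU: "rk \<Pi> U = n" using rank U by blast
  have n2: "n = Suc (Suc r)"
    using n adjacent_or_eq_in[OF assms(1,2) _ STU] ng sU rU unfolding vert_def by blast
  obtain t where t: "t \<in> T" "t \<notin> S" using vert_eq[OF assms(2,1)] ng(1) by blast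
  have tS: "t \<in> perp \<Pi> S" using t assms(3) by blast
  let ?W = "join (insert t S)"
  have hW: "hyperplane \<Pi> S ?W" using hyperplane_join[OF vert_singular[OF assms(1)] tS t(2)] .
  have up: "insert t S \<subseteq> ?W" using join_upper[of "insert t S"] t(1) pts by blast
  have vW: "vert (Suc r) ?W"
    using hyperplane_singular[OF hW] rk_hyperplane[OF hW] assms(1) unfolding vert_def by simp
  have WU: "?W \<subseteq> U"
    using join_insert_least[OF vert_singular[OF assms(1)] tS t(2) singular_subspaceD[OF sU] STU(1)] t(1) STU
    by blast
  have hU: "hyperplane \<Pi> ?W U"
    using hyperplane_rkI[OF sU subspace_join WU] rU n2 vW unfolding vert_def by simp
  have "\<not> T \<subseteq> ?W" using adjacent_or_eq_in[OF assms(1,2) vW] ng up by blast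
  then have hT: "hyperplane \<Pi> (T \<inter> ?W) T"
    using hyperplane_inter[OF hU vert_subspace[OF assms(2)] STU(2)] by blast
  have sT: "singular_subspace \<Pi> (T \<inter> ?W)" using hyperplane_singular hT by blast
  obtain s where s: "s \<in> S" "s \<notin> T" using vert_eq[OF assms(1,2)] ng(1) by blast
  have sp: "s \<in> perp \<Pi> (T \<inter> ?W)"
    using perp_swap[OF vert_points[OF assms(1)] assms(3)] s(1) perp_anti[of "T \<inter> ?W" T] by blast
  have sn: "s \<notin> T \<inter> ?W" using s by blast
  let ?V = "join (insert s (T \<inter> ?W))"
  have V: "vert r ?V" "hyperplane \<Pi> (T \<inter> ?W) ?V" using vert_joinI[OF hT assms(2) sp sn] .
  have "?V \<subseteq> ?W" using join_insert_least[OF sT sp sn subspace_join] s(1) up by blast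
  then have SV: "S = ?V \<or> gadj r S ?V" using adjacent_or_eq_in[OF assms(1) V(1) vW] up by blast
  have "?V \<subseteq> perp \<Pi> T" using \<open>?V \<subseteq> ?W\<close> WU singular_perp[OF sU] perp_anti[OF STU(2)] by blast
  then have "?V = T \<or> gadj r ?V T" using adjacent_or_eq[OF assms(2) V(1) _ hT V(2)] gadj_sym by blast
  then show False using SV assms(4) unfolding near_def by blast
qed

end

section \<open>Embeddings\<close>

text \<open>Preservation of distance 3 enters as \<open>far\<close>: the rank condition says that
  the ends of the path are at distance exactly 3.\<close>

locale dual_polar_embedding = D: ranked_polar \<Pi>' l + G: ranked_polar \<Pi> n
  for \<Pi>' :: "'a geometry" and l :: nat and \<Pi> :: "'b geometry" and n :: nat +
  fixes r :: nat and f :: "'a set \<Rightarrow> 'b set"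
  assumes rank_ge: "l \<ge> 3" and r_less: "r < n"
    and vert_image: "maximal_singular \<Pi>' M \<Longrightarrow> G.vert r (f M)"
    and inj: "\<lbrakk>maximal_singular \<Pi>' M; maximal_singular \<Pi>' N; f M = f N\<rbrakk> \<Longrightarrow> M = N"
    and adj_iff: "\<lbrakk>maximal_singular \<Pi>' M; maximal_singular \<Pi>' N\<rbrakk> \<Longrightarrow> G.gadj r (f M) (f N) \<longleftrightarrow> D.dadj M N"
    and far: "\<lbrakk>D.dadj M A; D.dadj A B; D.dadj B N; Suc (Suc (rk \<Pi>' (M \<inter> N))) < l\<rbrakk>
      \<Longrightarrow> \<not> G.near r (f M) (f N)"
begin

lemma gadj_image: "D.dadj M N \<Longrightarrow> G.gadj r (f M) (f N)"
  using adj_iff D.dadj_maximal by blast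

lemma not_adjacent_or_eq:
  assumes "maximal_singular \<Pi>' M" "maximal_singular \<Pi>' N" "Suc (Suc (rk \<Pi>' (M \<inter> N))) = l"
  shows "f M \<noteq> f N" "\<not> G.gadj r (f M) (f N)"
proof -
  have "\<not> D.dadj M N" using assms(3) unfolding D.dadj_def by simp
  then show "\<not> G.gadj r (f M) (f N)" using adj_iff assms by blast
  have "M \<noteq> N" using assms(3) D.rank[OF assms(1)] by auto
  then show "f M \<noteq> f N" using inj assms by blast
qed

text \<open>Two common neighbours have distinct images by injectivity, so
  \<open>common_neighbours_trace\<close> applies to every \<open>C\<close>.\<close>

lemma equal_traces:
  assumes "maximal_singular \<Pi>' M" "maximal_singular \<Pi>' N" "Suc (Suc (rk \<Pi>' (M \<inter> N))) = l"
    and "\<not> f N \<subseteq> perp \<Pi> (f M)" "D.dadj C M" "D.dadj C N"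
  shows "f M \<inter> f C = f N \<inter> f C"
proof -
  obtain W1 W2 where W: "D.dadj W1 M" "D.dadj W2 M" "D.dadj W1 N" "D.dadj W2 N" "W1 \<inter> M \<noteq> W2 \<inter> M"
    using D.two_common_neighbours[OF assms(1-3)] by blast
  have "f W1 \<noteq> f W2" using inj W D.dadj_maximal by blast
  moreover have "G.gadj r (f M) (f E) \<and> G.gadj r (f N) (f E)" if "D.dadj E M" "D.dadj E N" for E
    using that gadj_image D.dadj_sym by blast
  ultimately show ?thesis
    using G.common_neighbours_trace[of r "f M" "f W1" "f N" "f W2" "f C"] W assms(4-6) by blast
qed

text \<open>A common trace would be a hyperplane of both perpendicular images and make them equal or
  adjacent, although \<open>M\<close> and \<open>N\<close> are neither.\<close>

lemma distinct_traces:
  assumes "maximal_singular \<Pi>' M" "maximal_singular \<Pi>' N" "Suc (Suc (rk \<Pi>' (M \<inter> N))) = l"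
    and "f N \<subseteq> perp \<Pi> (f M)" "D.dadj C M" "D.dadj C N"
  shows "f M \<inter> f C \<noteq> f N \<inter> f C"
proof
  assume eq: "f M \<inter> f C = f N \<inter> f C"
  have "hyperplane \<Pi> (f M \<inter> f C) (f M)" "hyperplane \<Pi> (f N \<inter> f C) (f N)"
    using G.gadj_hyperplane gadj_image D.dadj_sym assms(5,6) by blast+
  then have "f M = f N \<or> G.gadj r (f M) (f N)"
    using G.adjacent_or_eq[OF vert_image vert_image] assms(1,2,4) eq by simp
  then show False using not_adjacent_or_eq[OF assms(1-3)] by blast
qed

lemma perp_distance_two:
  assumes "maximal_singular \<Pi>' M" "maximal_singular \<Pi>' N" "Suc (Suc (rk \<Pi>' (M \<inter> N))) = l"
  shows "f N \<subseteq> perp \<Pi> (f M)"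
proof (rule ccontr)
  assume np: "\<not> ?thesis"
  obtain W1 W2 X K where
    W: "D.dadj W1 M" "D.dadj W2 M" "D.dadj W1 N" "D.dadj W2 N" "W1 \<noteq> W2"
    and X: "D.dadj X M" and K: "D.dadj K X" "D.dadj K W1"
    and KM: "Suc (Suc (rk \<Pi>' (K \<inter> M))) = l" and KN: "Suc (Suc (rk \<Pi>' (K \<inter> N))) = l"
    and XN: "Suc (Suc (rk \<Pi>' (X \<inter> N))) < l" and KW: "Suc (Suc (rk \<Pi>' (K \<inter> W2))) < l"
    using D.hexagon_configuration[OF assms rank_ge] by blast
  have mK: "maximal_singular \<Pi>' K" using K D.dadj_maximal by blast
  define Z where "Z = f M \<inter> perp \<Pi> (f N)"
  have trM: "f M \<inter> f C = Z" if "D.dadj C M" "D.dadj C N" for C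
    unfolding Z_def using G.common_neighbour_trace[of r "f M" "f C" "f N"] that np gadj_image D.dadj_sym by blast
  have trN: "f N \<inter> f C = Z" if "D.dadj C M" "D.dadj C N" for C
    using equal_traces[OF assms np that] trM[OF that] by simp
  have hyp: "hyperplane \<Pi> (f A \<inter> f B) (f A)" "hyperplane \<Pi> (f A \<inter> f B) (f B)" if "D.dadj A B" for A B
    using G.gadj_hyperplane G.gadj_hyperplane' gadj_image that by blast+
  have hM: "hyperplane \<Pi> Z (f M)" and hN: "hyperplane \<Pi> Z (f N)" and hW2: "hyperplane \<Pi> Z (f W2)"
    using hyp[OF W(1)] hyp[OF W(3)] hyp[OF W(2)] trM[OF W(1,3)] trN[OF W(1,3)] trM[OF W(2,4)]
    by (simp_all add: Int_commute)
  have vX: "G.vert r (f X)" and vK: "G.vert r (f K)" and vN: "G.vert r (f N)" and vW2: "G.vert r (f W2)"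
    and vM: "G.vert r (f M)"
    using vert_image D.dadj_maximal X K W assms by blast+
  have Z: "subspace \<Pi> Z" "r = Suc (rk \<Pi> Z)"
    using G.hyperplane_singular[OF hM] G.singular_subspaceD G.rk_hyperplane[OF hM] vM
    unfolding G.vert_def by auto
  have star: "hyperplane \<Pi> Z (f A)" if "G.vert r (f A)" "Z \<subseteq> f A" for A
    using G.hyperplane_rkI[of "f A" Z] that Z unfolding G.vert_def by simp
  \<comment> \<open>An image containing \<open>Z\<close> lies in the star of \<open>Z\<close>, hence
    within distance 2 of \<open>f N\<close> and of \<open>f W2\<close>. But \<open>X\<close> is at
    distance 3 from \<open>N\<close>, and, for the next step, \<open>K\<close> from
    \<open>W2\<close>.\<close>
  have ZX: "\<not> Z \<subseteq> f X"
    using far[OF X D.dadj_sym[OF W(1)] W(3) XN] G.near_in_star[OF vX vN star[OF vX] hN r_less] by blast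
  have ZK: "\<not> Z \<subseteq> f K"
    using far[OF K(2) W(3) D.dadj_sym[OF W(4)] KW] G.near_in_star[OF vK vW2 star[OF vK] hW2 r_less] by blast
  \<comment> \<open>Otherwise \<open>f K\<close> and \<open>f N\<close> would have the same trace on
    \<open>f W1\<close>. For \<open>f N\<close> this trace is \<open>Z\<close>, which is not
    contained in \<open>f K\<close>.\<close>
  have KpN: "f N \<subseteq> perp \<Pi> (f K)"
    using equal_traces[OF mK assms(2) KN _ D.dadj_sym[OF K(2)] W(3)] trN[OF W(1,3)] ZK by blast
  have "f M \<subseteq> perp \<Pi> (f K)"
    using equal_traces[OF mK assms(1) KM _ D.dadj_sym[OF K(2)] W(1)] trM[OF W(1,3)] ZK by blast
  then have ne: "f K \<inter> f X \<noteq> f M \<inter> f X"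
    using distinct_traces[OF mK assms(1) KM _ D.dadj_sym[OF K(1)] X] by blast
  \<comment> \<open>Distinct hyperplanes of \<open>f X\<close> do not contain one another.\<close>
  have "\<not> f K \<inter> f X \<subseteq> f M \<inter> f X"
  proof
    assume "f K \<inter> f X \<subseteq> f M \<inter> f X"
    moreover have "subspace \<Pi> (f M \<inter> f X)"
      using G.subspace_inter G.vert_subspace vM vX by blast
    moreover have "f M \<inter> f X \<subset> f X" using G.hyperplane_psubset[OF hyp(1)[OF X]] by blast
    ultimately show False using G.hyperplane_maximal[OF hyp(2)[OF K(1)]] ne by blast
  qed
  then obtain v where v: "v \<in> f K" "v \<in> f X" "v \<notin> f M" by blast
  have "v \<in> perp \<Pi> (f N)" using G.perp_swap[OF G.vert_points[OF vK] KpN] v(1) by blast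
  then have "G.near r (f X) (f N)"
    using G.near_of_common_part[OF gadj_image[OF X] hM ZX vN hN v(2,3)] by blast
  then show False using far[OF X D.dadj_sym[OF W(1)] W(3) XN] by blast
qed

lemma perp_image:
  assumes "maximal_singular \<Pi>' X" "maximal_singular \<Pi>' Y"
  shows "f Y \<subseteq> perp \<Pi> (f X)"
  using assms(2)
proof (induction "l - rk \<Pi>' (X \<inter> Y)" arbitrary: Y rule: less_induct)
  case less
  show ?case
  proof (cases "Suc (rk \<Pi>' (X \<inter> Y)) < l")
    case False
    then have "X = Y \<or> D.dadj X Y" using D.dadjI[OF assms(1) less.prems] by linarith
    then show ?thesis
      using G.singular_perp[OF G.vert_singular[OF vert_image[OF assms(1)]]] G.gadj_perp gadj_image by blast
  next
    case True
    then obtain B1 B2 where B: "D.dadj B1 Y" "D.dadj B2 Y" "B1 \<inter> Y \<noteq> B2 \<inter> Y"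
      "rk \<Pi>' (X \<inter> Y) < rk \<Pi>' (X \<inter> B1)" "rk \<Pi>' (X \<inter> Y) < rk \<Pi>' (X \<inter> B2)"
      using D.two_closer_neighbours[OF assms(1) less.prems] by blast
    have mB: "maximal_singular \<Pi>' B1" "maximal_singular \<Pi>' B2" using B D.dadj_maximal by blast+
    have IH: "f B1 \<subseteq> perp \<Pi> (f X)" "f B2 \<subseteq> perp \<Pi> (f X)"
      using less.hyps[of B1] less.hyps[of B2] B mB True by auto
    \<comment> \<open>\<open>B1\<close> and \<open>B2\<close> are at distance 2, so their images are
      perpendicular and leave distinct traces on \<open>f Y\<close>; one trace and a point of the
      other generate \<open>f Y\<close>.\<close>
    have BB: "Suc (Suc (rk \<Pi>' (B1 \<inter> B2))) = l" using D.common_neighbour_inter(2)[OF B(1-3)] .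
    have ne: "f B1 \<inter> f Y \<noteq> f B2 \<inter> f Y"
      using distinct_traces[OF mB BB perp_distance_two[OF mB BB]] B D.dadj_sym by blast
    have h: "hyperplane \<Pi> (f B1 \<inter> f Y) (f Y)" "hyperplane \<Pi> (f B2 \<inter> f Y) (f Y)"
      using G.gadj_hyperplane' gadj_image B by blast+
    have "\<not> f B2 \<inter> f Y \<subseteq> f B1 \<inter> f Y"
      using G.hyperplane_maximal[OF h(2) G.singular_subspaceD] G.hyperplane_singular[OF h(1)]
        G.hyperplane_psubset[OF h(1)] ne by metis
    then obtain b where b: "b \<in> f Y" "b \<notin> f B1 \<inter> f Y" "b \<in> f B2" by blast
    then show ?thesis
      using G.hyperplane_generates[OF h(1) b(1,2) G.subspace_perp] IH by blast
  qed
qed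

text \<open>A pair at distance 3 has perpendicular images that are not near, so
  \<open>far_rank\<close> applies; for \<open>r = k + 1\<close> this is
  \<open>k \<le> n - 4\<close>.\<close>

lemma rank_bound: "r + 3 \<le> n"
proof -
  obtain X A B N where *: "D.dadj X A" "D.dadj A B" "D.dadj B N" "Suc (Suc (rk \<Pi>' (X \<inter> N))) < l"
    using D.distance_three_exists[OF rank_ge] by blast
  then have m: "maximal_singular \<Pi>' X" "maximal_singular \<Pi>' N" using D.dadj_maximal by blast+
  show ?thesis
    using G.far_rank[OF vert_image[OF m(1)] vert_image[OF m(2)] perp_image[OF m] far[OF *] r_less] .
qed

lemma singular_hull:
  obtains U where "singular_subspace \<Pi> U" "\<And>M. maximal_singular \<Pi>' M \<Longrightarrow> f M \<subseteq> U"
proof -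
  let ?A = "\<Union>{f M | M. maximal_singular \<Pi>' M}"
  have pts: "?A \<subseteq> points \<Pi>" using vert_image G.vert_points by blast
  have "?A \<subseteq> perp \<Pi> ?A"
  proof
    fix x assume "x \<in> ?A"
    then obtain M where M: "maximal_singular \<Pi>' M" "x \<in> f M" by blast
    have "collinear \<Pi> x a" if a: "a \<in> ?A" for a
    proof -
      obtain N where "maximal_singular \<Pi>' N" "a \<in> f N" using a by blast
      then show ?thesis using perp_image[OF _ M(1), of N] M(2) unfolding perp_def by blast
    qed
    then show "x \<in> perp \<Pi> ?A" using pts \<open>x \<in> ?A\<close> unfolding perp_def by blast
  qed
  then have "singular_subspace \<Pi> (G.join ?A)" by (rule G.join_singular)
  moreover have "f M \<subseteq> G.join ?A" if "maximal_singular \<Pi>' M" for M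
    using G.join_upper[OF pts] that by blast
  ultimately show ?thesis by (rule that)
qed

end

section \<open>Translation of graph distances and dimensions into ranks\<close>

lemma graph_dist_le: "(x, y) \<in> adj G ^^ m \<Longrightarrow> graph_dist G x y \<le> enat m"
  unfolding graph_dist_def by (rule INF_lower) simp

text \<open>The infimum of a nonempty set of path lengths is attained, and for the empty set it is
  infinite, which the finite bound excludes.\<close>

lemma graph_dist_leD:
  assumes "graph_dist G x y \<le> enat m"
  obtains i where "i \<le> m" "(x, y) \<in> adj G ^^ i"
proof -
  let ?A = "{m. (x, y) \<in> adj G ^^ m}"
  have "?A \<noteq> {}"
  proof
    assume "?A = {}"
    then have "graph_dist G x y = \<infinity>" unfolding graph_dist_def by (simp add: top_enat_def)
    then show False using assms by simp
  qed
  then obtain i where "i \<in> ?A" by blast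
  then have "Inf (enat ` ?A) \<in> enat ` ?A" by (intro wellorder_InfI[of "enat i"]) blast
  then obtain j where "j \<in> ?A" "graph_dist G x y = enat j" unfolding graph_dist_def by auto
  then show ?thesis using that[of j] assms by simp
qed

lemma polar_space_weak:
  assumes "polar_space \<Pi>"
  shows "weak_polar \<Pi>"
proof -
  have *: "\<forall>L\<in>lines \<Pi>. L \<subseteq> points \<Pi> \<and> (\<exists>p\<in>L. \<exists>q\<in>L. p \<noteq> q)"
    "\<forall>L\<in>lines \<Pi>. \<forall>M\<in>lines \<Pi>. \<forall>p q. p \<noteq> q \<longrightarrow> {p, q} \<subseteq> L \<inter> M \<longrightarrow> L = M"
    "\<forall>p\<in>points \<Pi>. \<not> (\<forall>q\<in>points \<Pi>. collinear \<Pi> p q)"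
    "\<forall>p\<in>points \<Pi>. \<forall>L\<in>lines \<Pi>. (\<exists>!q. q \<in> L \<and> collinear \<Pi> p q) \<or> (\<forall>q\<in>L. collinear \<Pi> p q)"
    using assms unfolding polar_space_def partial_linear_space_def by simp_all
  show ?thesis
  proof
    show "L = M" if "L \<in> lines \<Pi>" "M \<in> lines \<Pi>" "p \<noteq> q" "p \<in> L" "q \<in> L" "p \<in> M" "q \<in> M"
      for L M p q
      using *(2) that by simp
  qed (use * in simp_all)
qed

lemma polar_space_polar: "polar_space \<Pi> \<Longrightarrow> polar \<Pi>"
  by (intro polar.intro polar_space_weak polar_axioms.intro) (auto simp: polar_space_def)

lemma ranked_polarI:
  assumes "polar_space \<Pi>" "has_rank \<Pi> n"
  shows "ranked_polar \<Pi> n"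
proof -
  interpret polar \<Pi> using polar_space_polar assms(1) .
  show ?thesis
  proof
    fix M assume M: "maximal_singular \<Pi> M"
    then have "has_dim \<Pi> M (int n - 1)" using assms(2) unfolding has_rank_def by blast
    then show "rk \<Pi> M = n" using has_dim_iff[OF maximal_singularD[OF M]] by simp
  qed
qed

context ranked_polar
begin

lemma grassmannian_iff: "S \<in> grassmannian \<Pi> (int r - 1) \<longleftrightarrow> vert r S"
  unfolding grassmannian_def vert_def using has_dim_iff by auto

lemma adj_polar_grassmann_graph: "(S, T) \<in> adj (polar_grassmann_graph \<Pi> (int r - 1)) \<longleftrightarrow> gadj r S T"
  using grassmannian_iff[of _ r] grassmannian_iff[of _ "Suc r"]
  unfolding polar_grassmann_graph_def gadj_def by auto

lemma near_path:
  assumes "near r S T"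
  obtains m where "m \<le> 2" "(S, T) \<in> adj (polar_grassmann_graph \<Pi> (int r - 1)) ^^ m"
proof -
  let ?R = "adj (polar_grassmann_graph \<Pi> (int r - 1))"
  obtain C where "S = C \<or> (S, C) \<in> ?R" "C = T \<or> (C, T) \<in> ?R"
    using assms unfolding near_def adj_polar_grassmann_graph by blast
  then have "S = T \<or> (S, T) \<in> ?R \<or> (S, T) \<in> ?R O ?R" by blast
  then consider "(S, T) \<in> ?R ^^ 0" | "(S, T) \<in> ?R ^^ 1" | "(S, T) \<in> ?R ^^ 2"
    by (auto simp: numeral_2_eq_2)
  then show ?thesis using that[of 0] that[of 1] that[of 2] by cases auto
qed

lemma adj_dual_polar_graph: "(M, N) \<in> adj (dual_polar_graph \<Pi> n) \<longleftrightarrow> dadj M N"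
proof -
  have "has_dim \<Pi> (M \<inter> N) (int n - 2) \<longleftrightarrow> Suc (rk \<Pi> (M \<inter> N)) = n" if "maximal M" "maximal N"
    using has_dim_iff[OF singular_maximal_inter[OF that]] by auto
  then show ?thesis unfolding dual_polar_graph_def dadj_def by auto
qed

lemma short_path_rk:
  assumes "(M, N) \<in> adj (dual_polar_graph \<Pi> n) ^^ m" "m \<le> 2" "maximal M"
  shows "n \<le> Suc (Suc (rk \<Pi> (M \<inter> N)))"
proof -
  consider "m = 0" | "m = Suc 0" | "m = Suc (Suc 0)" using assms(2) by linarith
  then show ?thesis
  proof cases
    case 1
    then show ?thesis using assms rank by simp
  next
    case 2
    then show ?thesis using assms adj_dual_polar_graph unfolding dadj_def by auto
  next
    case 3
    then show ?thesis using assms two_step_rk by (auto simp: adj_dual_polar_graph)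
  qed
qed

end

theorem theorem2:
  fixes \<Pi>' :: "'a geometry" and \<Pi> :: "'b geometry"
    and l n :: nat and k :: int and f :: "'a set \<Rightarrow> 'b set"
  assumes "polar_space \<Pi>'" and "has_rank \<Pi>' l" and "l \<ge> 3"
    and "polar_space \<Pi>" and "has_rank \<Pi> n" and "k \<le> int n - 2"
    and "m_embedding 3 (dual_polar_graph \<Pi>' l) (polar_grassmann_graph \<Pi> k) f"
  shows "k \<le> int n - 4 \<and>
    (\<exists>U. singular_subspace \<Pi> U \<and>
      f ` verts (dual_polar_graph \<Pi>' l) \<subseteq> grassmannian_in \<Pi> U k)"
proof -
  interpret D: ranked_polar \<Pi>' l using ranked_polarI assms by blast
  interpret G: ranked_polar \<Pi> n using ranked_polarI assms by blast
  let ?D = "dual_polar_graph \<Pi>' l" and ?G = "polar_grassmann_graph \<Pi> k"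
  have vD: "verts ?D = {M. maximal_singular \<Pi>' M}" unfolding dual_polar_graph_def by simp
  have vG: "verts ?G = grassmannian \<Pi> k" unfolding polar_grassmann_graph_def by simp
  have emb: "f ` verts ?D \<subseteq> verts ?G" "inj_on f (verts ?D)"
    "\<And>x y. \<lbrakk>x \<in> verts ?D; y \<in> verts ?D\<rbrakk> \<Longrightarrow> (x, y) \<in> adj ?D \<longleftrightarrow> (f x, f y) \<in> adj ?G"
    "\<And>x y. \<lbrakk>x \<in> verts ?D; y \<in> verts ?D; graph_dist ?D x y \<le> enat 3\<rbrakk> \<Longrightarrow>
      graph_dist ?G (f x) (f y) = graph_dist ?D x y"
    using assms(7) unfolding m_embedding_def graph_embedding_def by auto
  \<comment> \<open>An image vertex is needed to write the integer \<open>k\<close> as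
    \<open>r - 1\<close> with a natural number \<open>r\<close>.\<close>
  obtain M0 where M0: "maximal_singular \<Pi>' M0" using D.maximal_exists[OF D.singular_empty] by blast
  define r where "r = rk \<Pi> (f M0)"
  have "f M0 \<in> grassmannian \<Pi> k" using emb(1) M0 vD vG by blast
  then have k: "k = int r - 1" unfolding grassmannian_def r_def using G.has_dim_iff by auto
  have aG: "(S, T) \<in> adj ?G \<longleftrightarrow> G.gadj r S T" for S T unfolding k by (rule G.adj_polar_grassmann_graph)
  interpret E: dual_polar_embedding \<Pi>' l \<Pi> n r f
  proof
    show "r < n" using assms(6) k by simp
    show "G.vert r (f M)" if "maximal_singular \<Pi>' M" for M
      using emb(1) that vD vG G.grassmannian_iff[of _ r] k by auto
    show "M = N" if "maximal_singular \<Pi>' M" "maximal_singular \<Pi>' N" "f M = f N" for M N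
      using emb(2) that vD by (simp add: inj_on_def)
    show "G.gadj r (f M) (f N) \<longleftrightarrow> D.dadj M N" if "maximal_singular \<Pi>' M" "maximal_singular \<Pi>' N" for M N
      using emb(3)[of M N] that vD aG D.adj_dual_polar_graph by simp
    show "\<not> G.near r (f M) (f N)"
      if d: "D.dadj M A" "D.dadj A B" "D.dadj B N" "Suc (Suc (rk \<Pi>' (M \<inter> N))) < l" for M A B N
    proof
      assume "G.near r (f M) (f N)"
      then obtain m where m: "m \<le> 2" "(f M, f N) \<in> adj ?G ^^ m" using G.near_path k by metis
      have mMN: "maximal_singular \<Pi>' M" "maximal_singular \<Pi>' N" using d D.dadj_maximal by blast+
      \<comment> \<open>The path puts the pair in the range where \<open>f\<close> preserves
        distance. Near images would then give a path of length at most 2 from \<open>M\<close> to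
        \<open>N\<close>, which the rank of \<open>M \<inter> N\<close> forbids.\<close>
      have "(M, N) \<in> adj ?D ^^ 3"
        using d(1-3) D.adj_dual_polar_graph by (auto simp: numeral_3_eq_3)
      then have "graph_dist ?G (f M) (f N) = graph_dist ?D M N"
        using emb(4)[OF _ _ graph_dist_le] mMN vD by simp
      then have "graph_dist ?D M N \<le> enat m" using graph_dist_le[OF m(2)] by simp
      then obtain i where "i \<le> m" "(M, N) \<in> adj ?D ^^ i" by (rule graph_dist_leD)
      then show False using D.short_path_rk[of M N i] m(1) mMN(1) d(4) by simp
    qed
  qed (use assms(3) in simp)
  obtain U where U: "singular_subspace \<Pi> U" "\<And>M. maximal_singular \<Pi>' M \<Longrightarrow> f M \<subseteq> U"
    using E.singular_hull by metis
  have "f ` verts ?D \<subseteq> grassmannian_in \<Pi> U k"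
    using U(2) emb(1) vD vG unfolding grassmannian_in_def by auto
  moreover have "k \<le> int n - 4" using E.rank_bound k by simp
  ultimately show ?thesis using U(1) by blast
qed

end
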